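(* Let $G$ be a graph and let $G_1,G_2$ be subgraphs of $G$ on the same vertex set whose edge sets partition the edge set of $G$. Suppose that whenever $j,k$ lie in the same connected component of $G_2$, then for every vertex $i\notin\{j,k\}$, $\{i,j\}$ is an edge of $G_1$ if and only if $\{i,k\}$ is an edge of $G_1$. Then the multiplication map $\mathcal E_{G_1}\otimes\mathcal E_{G_2}\to\mathcal E_G$, $a\otimes b\mapsto ab$, is an isomorphism of $\mathcal E_{G_1}$-$\mathcal E_{G_2}$-bimodules. In particular $\mathcal H_{G_1}(t)\mathcal H_{G_2}(t)=\mathcal H_G(t)$.
   Context: Let $n\ge 1$. The Fomin–Kirillov algebra $\mathcal E_n$ is the associative $\mathbb Q$-algebra with generators $x_{ij}$ for ordered pairs of distinct $i,j\in[n]$, subject to $x_{ij}=-x_{ji}$, $x_{ij}^2=0$, $x_{ij}x_{kl}=x_{kl}x_{ij}$ for distinct $i,j,k,l$, and $x_{ij}x_{jk}+x_{jk}x_{ki}+x_{ki}x_{ij}=0$ for distinct $i,j,k$. It is graded by degree. For a simple graph $G$ on vertex set $[n]$, $\mathcal E_G$ is the subalgebra of $\mathcal E_n$ generated by the $x_{ij}$ with $\{i,j\}$ an edge of $G$; its Hilbert series is $\mathcal H_G(t)=\sum_d\dim\mathcal E_G^d\,t^d$ where $\mathcal E_G^d$ is the degree-$d$ part. *)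

theory Defs
  imports "HOL-Library.Poly_Mapping" "HOL-Computational_Algebra.Formal_Power_Series"
begin

type_synonym 'v word = "('v \<times> 'v) list"
type_synonym 'v fa = "'v word \<Rightarrow>\<^sub>0 rat"

lift_definition fa_scale :: "rat \<Rightarrow> ('b \<Rightarrow>\<^sub>0 rat) \<Rightarrow> ('b \<Rightarrow>\<^sub>0 rat)"
  is "\<lambda>c f k. c * f k"
proof -
  fix c :: rat and f :: "'b \<Rightarrow> rat"
  assume "finite {k. f k \<noteq> 0}"
  then show "finite {k. c * f k \<noteq> 0}"
    by (rule rev_finite_subset) auto
qed

lemma lookup_fa_scale [simp]: "Poly_Mapping.lookup (fa_scale c p) k = c * Poly_Mapping.lookup p k"
  by transfer simp

definition fa_mul :: "'v fa \<Rightarrow> 'v fa \<Rightarrow> 'v fa" where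
  "fa_mul p q = (\<Sum>u\<in>Poly_Mapping.keys p. \<Sum>v\<in>Poly_Mapping.keys q. Poly_Mapping.single (u @ v) (Poly_Mapping.lookup p u * Poly_Mapping.lookup q v))"

definition fa_gen :: "'v \<Rightarrow> 'v \<Rightarrow> 'v fa" where
  "fa_gen i j = Poly_Mapping.single [(i, j)] 1"

text \<open>Defining relations of the Fomin--Kirillov algebra.  The free algebra has a letter
  for every pair (i,j); the letters with i = j do not occur in the FK algebra and are killed
  by an extra relation, so that the quotient is exactly the Fomin--Kirillov algebra on the
  vertex type.\<close>
definition fk_rels :: "'v fa set" where
  "fk_rels =
     {fa_gen i j + fa_gen j i | i j. i \<noteq> j}
   \<union> {fa_gen i i | i. True}
   \<union> {fa_mul (fa_gen i j) (fa_gen i j) | i j. i \<noteq> j}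
   \<union> {fa_mul (fa_gen i j) (fa_gen k l) - fa_mul (fa_gen k l) (fa_gen i j) | i j k l. distinct [i, j, k, l]}
   \<union> {fa_mul (fa_gen i j) (fa_gen j k) + fa_mul (fa_gen j k) (fa_gen k i)
        + fa_mul (fa_gen k i) (fa_gen i j) | i j k. distinct [i, j, k]}"

inductive_set fk_ideal :: "'v fa set" where
  zero: "0 \<in> fk_ideal"
| gen: "r \<in> fk_rels \<Longrightarrow> fa_mul (fa_mul a r) b \<in> fk_ideal"
| add: "p \<in> fk_ideal \<Longrightarrow> q \<in> fk_ideal \<Longrightarrow> p + q \<in> fk_ideal"
| scale: "p \<in> fk_ideal \<Longrightarrow> fa_scale c p \<in> fk_ideal"

lemma fa_scale_neg1: "fa_scale (-1) p = - p"
  by (rule poly_mapping_eqI) simp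

lemma fk_ideal_uminus: "p \<in> fk_ideal \<Longrightarrow> - p \<in> fk_ideal"
  using fk_ideal.scale[of p "-1"] by (simp add: fa_scale_neg1)

lemma fk_ideal_diff: "p \<in> fk_ideal \<Longrightarrow> q \<in> fk_ideal \<Longrightarrow> p - q \<in> fk_ideal"
  using fk_ideal.add[OF _ fk_ideal_uminus] by (simp add: diff_conv_add_uminus del: add_uminus_conv_diff)

quotient_type 'v fk = "'v fa" / "\<lambda>p q. p - q \<in> fk_ideal"
proof (rule equivpI)
  show "reflp (\<lambda>p q :: 'v fa. p - q \<in> fk_ideal)"
    by (rule reflpI) (simp add: fk_ideal.zero)
  show "symp (\<lambda>p q :: 'v fa. p - q \<in> fk_ideal)"
  proof (rule sympI)
    fix p q :: "'v fa" assume "p - q \<in> fk_ideal"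
    then have "- (p - q) \<in> fk_ideal" by (rule fk_ideal_uminus)
    then show "q - p \<in> fk_ideal" by simp
  qed
  show "transp (\<lambda>p q :: 'v fa. p - q \<in> fk_ideal)"
  proof (rule transpI)
    fix p q r :: "'v fa" assume "p - q \<in> fk_ideal" "q - r \<in> fk_ideal"
    then have "(p - q) + (q - r) \<in> fk_ideal" by (rule fk_ideal.add)
    then show "p - r \<in> fk_ideal" by simp
  qed
qed

instantiation fk :: (type) ab_group_add
begin

lift_definition zero_fk :: "'a fk" is "0 :: 'a fa" .

lift_definition plus_fk :: "'a fk \<Rightarrow> 'a fk \<Rightarrow> 'a fk" is "(+)"
proof -
  fix p p' q q' :: "'a fa"
  assume "p - p' \<in> fk_ideal" "q - q' \<in> fk_ideal"
  then have "(p - p') + (q - q') \<in> fk_ideal" by (rule fk_ideal.add)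
  then show "p + q - (p' + q') \<in> fk_ideal" by (simp add: algebra_simps)
qed

lift_definition uminus_fk :: "'a fk \<Rightarrow> 'a fk" is "uminus"
proof -
  fix p p' :: "'a fa"
  assume "p - p' \<in> fk_ideal"
  then have "- (p - p') \<in> fk_ideal" by (rule fk_ideal_uminus)
  then show "- p - - p' \<in> fk_ideal" by (simp add: algebra_simps)
qed

lift_definition minus_fk :: "'a fk \<Rightarrow> 'a fk \<Rightarrow> 'a fk" is "(-)"
proof -
  fix p p' q q' :: "'a fa"
  assume "p - p' \<in> fk_ideal" "q - q' \<in> fk_ideal"
  then have "(p - p') - (q - q') \<in> fk_ideal" by (rule fk_ideal_diff)
  then show "p - q - (p' - q') \<in> fk_ideal" by (simp add: algebra_simps)
qed

instance
proof
  fix a b c :: "'a fk"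
  show "a + b + c = a + (b + c)" by transfer (simp add: fk_ideal.zero add.assoc)
  show "a + b = b + a" by transfer (simp add: fk_ideal.zero add.commute)
  show "0 + a = a" by transfer (simp add: fk_ideal.zero)
  show "- a + a = 0" by transfer (simp add: fk_ideal.zero)
  show "a - b = a + - b" by transfer (simp add: fk_ideal.zero)
qed

end

lift_definition fk_scale :: "rat \<Rightarrow> 'v fk \<Rightarrow> 'v fk" is fa_scale
proof -
  fix c :: rat and p q :: "'v fa"
  assume "p - q \<in> fk_ideal"
  then have "fa_scale c (p - q) \<in> fk_ideal" by (rule fk_ideal.scale)
  moreover have "fa_scale c (p - q) = fa_scale c p - fa_scale c q"
    by (rule poly_mapping_eqI) (simp add: lookup_minus algebra_simps)
  ultimately show "fa_scale c p - fa_scale c q \<in> fk_ideal" by simp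
qed

text \<open>Multiplication and unit, defined through representatives (well defined since
  fk_ideal is a two-sided ideal).\<close>
instantiation fk :: (type) "{times, one}"
begin
definition times_fk :: "'a fk \<Rightarrow> 'a fk \<Rightarrow> 'a fk" where
  "a * b = abs_fk (fa_mul (rep_fk a) (rep_fk b))"
definition one_fk :: "'a fk" where
  "one_fk = abs_fk (Poly_Mapping.single [] 1)"
instance ..
end

definition fk_gen :: "'v \<Rightarrow> 'v \<Rightarrow> 'v fk" where
  "fk_gen i j = abs_fk (fa_gen i j)"

inductive_set fk_subalg :: "('v \<times> 'v) set \<Rightarrow> 'v fk set" for S where
  one: "1 \<in> fk_subalg S"
| gen: "(i, j) \<in> S \<Longrightarrow> fk_gen i j \<in> fk_subalg S"
| add: "a \<in> fk_subalg S \<Longrightarrow> b \<in> fk_subalg S \<Longrightarrow> a + b \<in> fk_subalg S"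
| scale: "a \<in> fk_subalg S \<Longrightarrow> fk_scale c a \<in> fk_subalg S"
| mul: "a \<in> fk_subalg S \<Longrightarrow> b \<in> fk_subalg S \<Longrightarrow> a * b \<in> fk_subalg S"

text \<open>E_G for a simple graph given by a symmetric irreflexive edge relation E.\<close>
definition fkG :: "('v \<Rightarrow> 'v \<Rightarrow> bool) \<Rightarrow> 'v fk set" where
  "fkG E = fk_subalg {(i, j). E i j}"

definition fk_deg :: "nat \<Rightarrow> 'v fk set" where
  "fk_deg d = {abs_fk p | p. \<forall>w \<in> Poly_Mapping.keys p. length w = d}"

definition fk_hilb :: "('v \<Rightarrow> 'v \<Rightarrow> bool) \<Rightarrow> int fps" where
  "fk_hilb E = Abs_fps (\<lambda>d. int (vector_space.dim fk_scale (fkG E \<inter> fk_deg d)))"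

text \<open>U \<otimes> W is realised as the free Q-vector space on U \<times> W modulo the bilinearity
  relations; the multiplication map sends the basis vector (a,b) to a*b.\<close>
type_synonym 'v tens = "('v fk \<times> 'v fk) \<Rightarrow>\<^sub>0 rat"

definition tens_free :: "'v fk set \<Rightarrow> 'v fk set \<Rightarrow> 'v tens set" where
  "tens_free U W = {t. Poly_Mapping.keys t \<subseteq> U \<times> W}"

definition tens_rel_gens :: "'v fk set \<Rightarrow> 'v fk set \<Rightarrow> 'v tens set" where
  "tens_rel_gens U W =
     {Poly_Mapping.single (a + a', b) 1 - Poly_Mapping.single (a, b) 1 - Poly_Mapping.single (a', b) 1
        | a a' b. a \<in> U \<and> a' \<in> U \<and> b \<in> W}
   \<union> {Poly_Mapping.single (a, b + b') 1 - Poly_Mapping.single (a, b) 1 - Poly_Mapping.single (a, b') 1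
        | a b b'. a \<in> U \<and> b \<in> W \<and> b' \<in> W}
   \<union> {Poly_Mapping.single (fk_scale c a, b) 1 - fa_scale c (Poly_Mapping.single (a, b) 1)
        | c a b. a \<in> U \<and> b \<in> W}
   \<union> {Poly_Mapping.single (a, fk_scale c b) 1 - fa_scale c (Poly_Mapping.single (a, b) 1)
        | c a b. a \<in> U \<and> b \<in> W}"

definition tens_rel :: "'v fk set \<Rightarrow> 'v fk set \<Rightarrow> 'v tens set" where
  "tens_rel U W = module.span fa_scale (tens_rel_gens U W)"

definition tens_mult :: "'v tens \<Rightarrow> 'v fk" where
  "tens_mult t = (\<Sum>x \<in> Poly_Mapping.keys t. fk_scale (Poly_Mapping.lookup t x) (fst x * snd x))"

definition tens_lact :: "'v fk \<Rightarrow> 'v tens \<Rightarrow> 'v tens" where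
  "tens_lact a t = (\<Sum>x \<in> Poly_Mapping.keys t. Poly_Mapping.single (a * fst x, snd x) (Poly_Mapping.lookup t x))"

definition tens_ract :: "'v tens \<Rightarrow> 'v fk \<Rightarrow> 'v tens" where
  "tens_ract t b = (\<Sum>x \<in> Poly_Mapping.keys t. Poly_Mapping.single (fst x, snd x * b) (Poly_Mapping.lookup t x))"

text \<open>The multiplication map U \<otimes> W \<rightarrow> V, a \<otimes> b \<mapsto> ab, is an isomorphism of
  U-W-bimodules: it is well defined and injective on the quotient (its kernel on the free
  space is exactly the bilinearity relations), it is onto V, and it intertwines the left
  U-action and right W-action.\<close>
definition mult_tensor_iso :: "'v fk set \<Rightarrow> 'v fk set \<Rightarrow> 'v fk set \<Rightarrow> bool" where
  "mult_tensor_iso U W V \<longleftrightarrow>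
     tens_mult ` tens_free U W = V
   \<and> (\<forall>t \<in> tens_free U W. tens_mult t = 0 \<longleftrightarrow> t \<in> tens_rel U W)
   \<and> (\<forall>a \<in> U. \<forall>t \<in> tens_free U W. tens_lact a t \<in> tens_free U W \<and> tens_mult (tens_lact a t) = a * tens_mult t)
   \<and> (\<forall>b \<in> W. \<forall>t \<in> tens_free U W. tens_ract t b \<in> tens_free U W \<and> tens_mult (tens_ract t b) = tens_mult t * b)"

end

theory Submission
  imports Defs "HOL-Combinatorics.Transposition"
begin

text \<open>
  The space \<open>E_{G_1} E_{G_2}\<close> is closed under left multiplication by the generators of \<open>E_G\<close>:
  for \<open>{j,k}\<close> in \<open>G_2\<close> and \<open>{k,i}\<close> in \<open>G_1\<close> also \<open>{i,j}\<close> is in \<open>G_1\<close>, and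
  \<open>x_{jk} x_{ki} = - x_{ij} x_{jk} - x_{ki} x_{ij}\<close>. This gives surjectivity.

  For injectivity, recall that \<open>E_n\<close> is a braided Hopf algebra over the symmetric group, and that
  killing all \<open>x_{ij}\<close> with \<open>i\<close>, \<open>j\<close> in different components of \<open>G_2\<close> is an algebra
  endomorphism \<open>\<pi>\<close>. The hypothesis forces every edge of \<open>G_1\<close> to join different components of
  \<open>G_2\<close>, so \<open>(id \<otimes> \<pi>) \<Delta>\<close> sends \<open>ab\<close>, for \<open>a\<close> in \<open>E_{G_1}\<close> and \<open>b\<close> in \<open>E_{G_2}\<close> of
  degree \<open>d\<close>, to \<open>a \<otimes> b\<close> plus terms whose second factor has degree below \<open>d\<close>. Hence a nontrivial
  relation between products \<open>ab\<close> with the \<open>b\<close> linearly independent is impossible. To avoid the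
  braided tensor product, a linear functional \<open>l\<close> is applied to the second factor: the
  maps \<open>D_l = (id \<otimes> l \<pi>) \<Delta>\<close> satisfy the recursion
  \<open>D_l(x_{ij} w) = x_{ij} D_l(w) + s_{ij} . D_{l(\<pi>(x_{ij}) -)}(w)\<close>, which can be taken as their definition.
\<close>

section \<open>The ring structure\<close>

interpretation fa: vector_space "fa_scale :: rat \<Rightarrow> ('b \<Rightarrow>\<^sub>0 rat) \<Rightarrow> ('b \<Rightarrow>\<^sub>0 rat)"
  by unfold_locales (auto intro!: poly_mapping_eqI simp: lookup_add algebra_simps)

lemma fa_scale_single [simp]: "fa_scale c (Poly_Mapping.single w a) = Poly_Mapping.single w (c * a)"
  by (rule poly_mapping_eqI) (simp add: lookup_single when_def)

text \<open>Enlarging the index sets beyond the supports adds only zero terms, so products with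
  different supports can be compared over one common index set.\<close>

lemma fa_mul_over:
  assumes "finite A" "Poly_Mapping.keys p \<subseteq> A" "finite B" "Poly_Mapping.keys q \<subseteq> B"
  shows "fa_mul p q = (\<Sum>u\<in>A. \<Sum>v\<in>B.
    Poly_Mapping.single (u @ v) (Poly_Mapping.lookup p u * Poly_Mapping.lookup q v))"
proof -
  have "fa_mul p q = (\<Sum>u\<in>Poly_Mapping.keys p. \<Sum>v\<in>B.
      Poly_Mapping.single (u @ v) (Poly_Mapping.lookup p u * Poly_Mapping.lookup q v))"
    unfolding fa_mul_def using assms
    by (intro sum.cong refl sum.mono_neutral_left) (auto simp: in_keys_iff)
  also have "\<dots> = (\<Sum>u\<in>A. \<Sum>v\<in>B.
      Poly_Mapping.single (u @ v) (Poly_Mapping.lookup p u * Poly_Mapping.lookup q v))"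
    using assms by (intro sum.mono_neutral_left) (auto simp: in_keys_iff)
  finally show ?thesis .
qed

lemma fa_mul_single [simp]:
  "fa_mul (Poly_Mapping.single u a) (Poly_Mapping.single v b) = Poly_Mapping.single (u @ v) (a * b)"
  by (subst fa_mul_over[of "{u}" _ "{v}"]) (auto simp: lookup_single when_def split: if_splits)

lemma fa_mul_add_left: "fa_mul (p + p') q = fa_mul p q + fa_mul p' q"
proof -
  let ?A = "Poly_Mapping.keys p \<union> Poly_Mapping.keys p'"
  have "Poly_Mapping.keys (p + p') \<subseteq> ?A" by (rule Poly_Mapping.keys_add)
  then show ?thesis
    by (simp add: fa_mul_over[of ?A _ "Poly_Mapping.keys q"] sum.distrib[symmetric]
        lookup_add distrib_right single_add)
qed

lemma fa_mul_add_right: "fa_mul p (q + q') = fa_mul p q + fa_mul p q'"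
proof -
  let ?A = "Poly_Mapping.keys q \<union> Poly_Mapping.keys q'"
  have "Poly_Mapping.keys (q + q') \<subseteq> ?A" by (rule Poly_Mapping.keys_add)
  then show ?thesis
    by (simp add: fa_mul_over[of "Poly_Mapping.keys p" _ ?A] sum.distrib[symmetric]
        lookup_add distrib_left single_add)
qed

lemma fa_mul_zero [simp]: "fa_mul 0 q = 0" "fa_mul p 0 = 0"
  by (simp_all add: fa_mul_def)

lemma fa_mul_uminus: "fa_mul (- p) q = - fa_mul p q" "fa_mul p (- q) = - fa_mul p q"
  using fa_mul_add_left[of "- p" p q] fa_mul_add_right[of p "- q" q]
  by (simp_all add: eq_neg_iff_add_eq_0)

lemma fa_mul_diff: "fa_mul (p - p') q = fa_mul p q - fa_mul p' q"
    "fa_mul p (q - q') = fa_mul p q - fa_mul p q'"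
  using fa_mul_add_left[of p "- p'" q] fa_mul_add_right[of p q "- q'"]
  by (simp_all add: fa_mul_uminus)

lemma fa_sum_monomials:
  "(\<Sum>w\<in>Poly_Mapping.keys p. Poly_Mapping.single w (Poly_Mapping.lookup p w)) = (p :: 'b \<Rightarrow>\<^sub>0 rat)"
  by (rule poly_mapping_eqI)
    (auto simp: lookup_sum lookup_single when_def in_keys_iff sum.delta)

text \<open>Every element is a finite sum of monomials with coefficients, so linear identities need
  only be checked on monomials.\<close>

lemma fa_induct [case_names single add]:
  assumes "\<And>w c. P (Poly_Mapping.single w c)" "\<And>p q. P p \<Longrightarrow> P q \<Longrightarrow> P (p + q)"
  shows "P (p :: 'b \<Rightarrow>\<^sub>0 rat)"
proof -
  have "P (\<Sum>w\<in>A. Poly_Mapping.single w (Poly_Mapping.lookup p w))" if "finite A" for A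
    using that
  proof (induction A rule: finite_induct)
    case empty
    show ?case using assms(1)[of undefined 0] by simp
  qed (simp add: assms)
  from this[of "Poly_Mapping.keys p"] show ?thesis
    by (simp add: fa_sum_monomials)
qed

lemma fa_mul_assoc: "fa_mul (fa_mul p q) r = fa_mul p (fa_mul q r)"
proof (induction p rule: fa_induct)
  case (single u a)
  show ?case
  proof (induction q rule: fa_induct)
    case (single v b)
    show ?case
      by (induction r rule: fa_induct) (simp_all add: fa_mul_add_right mult.assoc)
  qed (simp add: fa_mul_add_left fa_mul_add_right)
qed (simp add: fa_mul_add_left)

lemma fa_mul_scale: "fa_mul (fa_scale c p) q = fa_scale c (fa_mul p q)"
    "fa_mul p (fa_scale c q) = fa_scale c (fa_mul p q)"
proof -
  \<comment> \<open>Scaling is multiplication by a multiple of the empty word, from either side;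
    both claims then follow from associativity.\<close>
  have 1: "fa_scale c p = fa_mul (Poly_Mapping.single [] c) p" for p
    by (induction p rule: fa_induct) (simp_all add: fa_mul_add_right fa.scale_right_distrib)
  have 2: "fa_scale c p = fa_mul p (Poly_Mapping.single [] c)" for p
    by (induction p rule: fa_induct) (simp_all add: fa_mul_add_left fa.scale_right_distrib mult.commute)
  show "fa_mul (fa_scale c p) q = fa_scale c (fa_mul p q)" by (simp add: 1 fa_mul_assoc)
  show "fa_mul p (fa_scale c q) = fa_scale c (fa_mul p q)" by (simp add: 2 fa_mul_assoc)
qed

section \<open>Passing to the quotient by the ideal of relations\<close>

lemma fk_ideal_mul: "p \<in> fk_ideal \<Longrightarrow> fa_mul (fa_mul a p) b \<in> fk_ideal"
proof (induction rule: fk_ideal.induct)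
  case (gen r a' b')
  have "fa_mul (fa_mul a (fa_mul (fa_mul a' r) b')) b = fa_mul (fa_mul (fa_mul a a') r) (fa_mul b' b)"
    by (simp add: fa_mul_assoc)
  then show ?case using gen by (simp add: fk_ideal.gen)
qed (auto simp: fa_mul_add_left fa_mul_add_right fa_mul_scale intro: fk_ideal.intros)

lemma fa_mul_one [simp]: "fa_mul (Poly_Mapping.single [] 1) p = p" "fa_mul p (Poly_Mapping.single [] 1) = p"
  by (induction p rule: fa_induct) (simp_all add: fa_mul_add_left fa_mul_add_right)

lemma abs_fk_eq_iff: "abs_fk p = abs_fk q \<longleftrightarrow> p - q \<in> fk_ideal"
  by (rule fk.abs_eq_iff)

lemma abs_fk_rep [simp]: "abs_fk (rep_fk a) = a"
  by (rule Quotient3_abs_rep[OF Quotient3_fk])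

lemma rep_abs_fk: "rep_fk (abs_fk p) - p \<in> fk_ideal"
  using abs_fk_eq_iff abs_fk_rep by blast

lemma fk_cases: obtains p where "a = abs_fk p"
  using abs_fk_rep by metis

lemma abs_fk_mul: "abs_fk p * abs_fk q = abs_fk (fa_mul p q)"
proof -
  let ?p = "rep_fk (abs_fk p)" and ?q = "rep_fk (abs_fk q)"
  \<comment> \<open>The difference of the two products is \<open>(?p - p) ?q + p (?q - q)\<close>.
    The empty words bring each summand into the two-sided form of
    \<open>fk_ideal_mul\<close>.\<close>
  have "fa_mul (fa_mul (Poly_Mapping.single [] 1) (?p - p)) ?q
      + fa_mul (fa_mul p (?q - q)) (Poly_Mapping.single [] 1) \<in> fk_ideal"
    by (intro fk_ideal.add fk_ideal_mul rep_abs_fk)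
  then show ?thesis
    unfolding times_fk_def abs_fk_eq_iff by (simp add: fa_mul_diff)
qed

lemma abs_fk_add: "abs_fk p + abs_fk q = abs_fk (p + q)"
  by (rule plus_fk.abs_eq)

lemma abs_fk_scale: "fk_scale c (abs_fk p) = abs_fk (fa_scale c p)"
  by (rule fk_scale.abs_eq)

instance fk :: (type) ring
proof
  fix a b c :: "'a fk"
  obtain p q r where [simp]: "a = abs_fk p" "b = abs_fk q" "c = abs_fk r" by (metis fk_cases)
  show "a * b * c = a * (b * c)" by (simp add: abs_fk_mul fa_mul_assoc)
  show "(a + b) * c = a * c + b * c" by (simp add: abs_fk_mul abs_fk_add fa_mul_add_left)
  show "a * (b + c) = a * b + a * c" by (simp add: abs_fk_mul abs_fk_add fa_mul_add_right)
qed

instance fk :: (type) monoid_mult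
proof
  fix a :: "'a fk"
  obtain p where [simp]: "a = abs_fk p" by (metis fk_cases)
  show "1 * a = a" "a * 1 = a" by (simp_all add: one_fk_def abs_fk_mul)
qed

interpretation fk: vector_space "fk_scale :: rat \<Rightarrow> 'v fk \<Rightarrow> 'v fk"
proof
  fix a b :: rat and x y :: "'v fk"
  obtain p q where [simp]: "x = abs_fk p" "y = abs_fk q" by (metis fk_cases)
  show "fk_scale a (x + y) = fk_scale a x + fk_scale a y"
    by (simp add: abs_fk_scale abs_fk_add fa.scale_right_distrib)
  show "fk_scale (a + b) x = fk_scale a x + fk_scale b x"
    by (simp add: abs_fk_scale abs_fk_add fa.scale_left_distrib)
  show "fk_scale a (fk_scale b x) = fk_scale (a * b) x" "fk_scale 1 x = x"
    by (simp_all add: abs_fk_scale)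
qed

lemma fk_scale_mult [simp]: "fk_scale c a * b = fk_scale c (a * b)" "a * fk_scale c b = fk_scale c (a * b)"
proof -
  obtain p q where [simp]: "a = abs_fk p" "b = abs_fk q" by (metis fk_cases)
  show "fk_scale c a * b = fk_scale c (a * b)" "a * fk_scale c b = fk_scale c (a * b)"
    by (simp_all add: abs_fk_scale abs_fk_mul fa_mul_scale)
qed

section \<open>Monomials as a spanning set\<close>

definition fk_mon :: "'v word \<Rightarrow> 'v fk" where
  "fk_mon w = abs_fk (Poly_Mapping.single w 1)"

lemma fk_mon_Nil [simp]: "fk_mon [] = 1"
  by (simp add: fk_mon_def one_fk_def)

lemma fk_mon_append: "fk_mon (u @ v) = fk_mon u * fk_mon v"
  by (simp add: fk_mon_def abs_fk_mul)

lemma fk_mon_Cons: "fk_mon ((i, j) # w) = fk_gen i j * fk_mon w"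
  by (simp add: fk_mon_def fk_gen_def fa_gen_def abs_fk_mul)

lemma fk_span_mon_keys: "abs_fk p \<in> fk.span (fk_mon ` Poly_Mapping.keys p)"
proof -
  have "abs_fk (\<Sum>w\<in>A. Poly_Mapping.single w (Poly_Mapping.lookup p w))
      = (\<Sum>w\<in>A. fk_scale (Poly_Mapping.lookup p w) (fk_mon w))" if "finite A" for A
    using that
    by (induction A rule: finite_induct)
      (simp_all add: zero_fk.abs_eq[symmetric] abs_fk_add[symmetric] fk_mon_def abs_fk_scale)
  then have "abs_fk p = (\<Sum>w\<in>Poly_Mapping.keys p. fk_scale (Poly_Mapping.lookup p w) (fk_mon w))"
    using finite_keys fa_sum_monomials by metis
  then show ?thesis
    by (metis (no_types, lifting) fk.span_sum fk.span_scale fk.span_base imageI)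
qed

lemma fk_span_mon: "a \<in> fk.span (range fk_mon)"
proof -
  obtain p where "a = abs_fk p" by (rule fk_cases)
  then show ?thesis
    using fk_span_mon_keys[of p] fk.span_mono[of "fk_mon ` Poly_Mapping.keys p" "range fk_mon"] by auto
qed

section \<open>The defining relations as equations in the quotient\<close>

lemma abs_fk_zero_if_rel: "r \<in> fk_rels \<Longrightarrow> abs_fk r = 0"
  using fk_ideal.gen[of r "Poly_Mapping.single [] 1" "Poly_Mapping.single [] 1"]
  by (simp add: zero_fk.abs_eq abs_fk_eq_iff)

lemma fk_gen_self [simp]: "fk_gen i i = 0"
  unfolding fk_gen_def by (rule abs_fk_zero_if_rel) (auto simp: fk_rels_def)

lemma fk_gen_swap: "fk_gen j i = - fk_gen i j"
proof (cases "i = j")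
  case False
  then have "abs_fk (fa_gen j i + fa_gen i j) = 0"
    by (intro abs_fk_zero_if_rel) (auto simp: fk_rels_def)
  then show ?thesis
    by (simp add: fk_gen_def abs_fk_add[symmetric] eq_neg_iff_add_eq_0)
qed simp

lemma fk_gen_square [simp]: "fk_gen i j * fk_gen i j = 0"
proof (cases "i = j")
  case False
  then have "abs_fk (fa_mul (fa_gen i j) (fa_gen i j)) = 0"
    by (intro abs_fk_zero_if_rel) (auto simp: fk_rels_def)
  then show ?thesis by (simp add: fk_gen_def abs_fk_mul)
qed simp

lemma fk_gen_commute:
  assumes "distinct [i, j, k, l]"
  shows "fk_gen i j * fk_gen k l = fk_gen k l * fk_gen i j"
proof -
  have "fa_mul (fa_gen i j) (fa_gen k l) - fa_mul (fa_gen k l) (fa_gen i j) \<in> fk_rels"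
    using assms unfolding fk_rels_def by blast
  from abs_fk_zero_if_rel[OF this] show ?thesis
    by (simp add: fk_gen_def abs_fk_mul minus_fk.abs_eq[symmetric])
qed

lemma fk_gen_triangle:
  assumes "distinct [i, j, k]"
  shows "fk_gen i j * fk_gen j k + fk_gen j k * fk_gen k i + fk_gen k i * fk_gen i j = 0"
proof -
  have "fa_mul (fa_gen i j) (fa_gen j k) + fa_mul (fa_gen j k) (fa_gen k i)
        + fa_mul (fa_gen k i) (fa_gen i j) \<in> fk_rels"
    using assms unfolding fk_rels_def by blast
  from abs_fk_zero_if_rel[OF this] show ?thesis
    by (simp add: fk_gen_def abs_fk_mul abs_fk_add[symmetric])
qed

text \<open>The elements satisfying \<open>P\<close> form a subspace containing all monomials, and
  these span the algebra.\<close>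

lemma fk_induct [case_names mon add scale]:
  assumes "\<And>w. P (fk_mon w)" "\<And>a b. P a \<Longrightarrow> P b \<Longrightarrow> P (a + b)" "\<And>c a. P a \<Longrightarrow> P (fk_scale c a)"
  shows "P a"
proof -
  have "fk.subspace {a. P a}"
    unfolding fk.subspace_def using assms(1)[of "[]"] assms(2,3)[of 1] assms(3)[of 1 0]
    by (auto intro: assms)
  then show ?thesis
    using fk.span_induct[OF fk_span_mon, of P] assms(1) by auto
qed

section \<open>Linear maps defined on words\<close>

abbreviation fk_linear :: "('v fk \<Rightarrow> 'v fk) \<Rightarrow> bool" where
  "fk_linear \<equiv> module_hom fk_scale fk_scale"

abbreviation fk_functional :: "('v fk \<Rightarrow> rat) \<Rightarrow> bool" where
  "fk_functional \<equiv> module_hom fk_scale (*)"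

lemma fk_linearI:
  "(\<And>x y. f (x + y) = f x + f y) \<Longrightarrow> (\<And>c x. f (fk_scale c x) = fk_scale c (f x)) \<Longrightarrow> fk_linear f"
  by (simp add: module_hom_iff fk.module_axioms)

lemma fk_functionalI:
  "(\<And>x y. f (x + y) = f x + f y) \<Longrightarrow> (\<And>c x. f (fk_scale c x) = c * f x) \<Longrightarrow> fk_functional f"
  by (simp add: module_hom_iff fk.module_axioms) (unfold_locales, simp_all add: algebra_simps)

lemma fk_linear_eqI:
  assumes "fk_linear f" "fk_linear g" "\<And>w. f (fk_mon w) = g (fk_mon w)"
  shows "f a = g a"
  by (induction a rule: fk_induct)
    (simp_all add: assms module_hom.add[OF assms(1)] module_hom.add[OF assms(2)]
      module_hom.scale[OF assms(1)] module_hom.scale[OF assms(2)])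

text \<open>Linear extension from basis elements. The index type is arbitrary because both words and
  pairs in the tensor product are used as bases.\<close>

definition fa_ext :: "('b \<Rightarrow> 'v fk) \<Rightarrow> ('b \<Rightarrow>\<^sub>0 rat) \<Rightarrow> 'v fk" where
  "fa_ext f p = (\<Sum>w\<in>Poly_Mapping.keys p. fk_scale (Poly_Mapping.lookup p w) (f w))"

lemma fa_ext_over:
  assumes "finite A" "Poly_Mapping.keys p \<subseteq> A"
  shows "fa_ext f p = (\<Sum>w\<in>A. fk_scale (Poly_Mapping.lookup p w) (f w))"
  unfolding fa_ext_def using assms by (intro sum.mono_neutral_left) (auto simp: in_keys_iff)

lemma fa_ext_single [simp]: "fa_ext f (Poly_Mapping.single w c) = fk_scale c (f w)"
  by (subst fa_ext_over[of "{w}"]) auto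

lemma fa_ext_add: "fa_ext f (p + q) = fa_ext f p + fa_ext f q"
proof -
  let ?A = "Poly_Mapping.keys p \<union> Poly_Mapping.keys q"
  have "Poly_Mapping.keys (p + q) \<subseteq> ?A" by (rule Poly_Mapping.keys_add)
  then show ?thesis
    by (simp add: fa_ext_over[of ?A] sum.distrib[symmetric] lookup_add fk.scale_left_distrib)
qed

lemma fa_ext_scale: "fa_ext f (fa_scale c p) = fk_scale c (fa_ext f p)"
  by (induction p rule: fa_induct) (simp_all add: fa_ext_add fa.scale_right_distrib fk.scale_right_distrib)

lemma fa_ext_diff: "fa_ext f (p - q) = fa_ext f p - fa_ext f q"
  using fa_ext_add[of f "p - q" q] by (simp add: algebra_simps)

lemma fa_ext_zero [simp]: "fa_ext f 0 = 0"
  by (simp add: fa_ext_def)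

text \<open>The condition for a map on words to descend to the quotient: its linear extension
  vanishes on every relation framed by words \<open>u\<close> and \<open>v\<close>.\<close>

definition fk_compatible :: "('v word \<Rightarrow> 'v fk) \<Rightarrow> bool" where
  "fk_compatible f \<longleftrightarrow> (\<forall>u v.
      (\<forall>i j. i \<noteq> j \<longrightarrow> f (u @ (i, j) # v) + f (u @ (j, i) # v) = 0)
    \<and> (\<forall>i. f (u @ (i, i) # v) = 0)
    \<and> (\<forall>i j. i \<noteq> j \<longrightarrow> f (u @ (i, j) # (i, j) # v) = 0)
    \<and> (\<forall>i j k l. distinct [i, j, k, l] \<longrightarrow> f (u @ (i, j) # (k, l) # v) = f (u @ (k, l) # (i, j) # v))
    \<and> (\<forall>i j k. distinct [i, j, k] \<longrightarrow> f (u @ (i, j) # (j, k) # v)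
        + f (u @ (j, k) # (k, i) # v) + f (u @ (k, i) # (i, j) # v) = 0))"

lemma fa_ext_rel:
  assumes "fk_compatible f" "r \<in> fk_rels"
  shows "fa_ext f (fa_mul (fa_mul (Poly_Mapping.single u a) r) (Poly_Mapping.single v b)) = 0"
  using assms(2) assms(1)[unfolded fk_compatible_def, rule_format, of u v] unfolding fk_rels_def
  by (auto simp: fa_gen_def fa_mul_add_left fa_mul_add_right fa_mul_diff fa_ext_add fa_ext_diff
      fk.scale_right_distrib[symmetric])

lemma fa_ext_ideal:
  assumes "fk_compatible f" "p \<in> fk_ideal"
  shows "fa_ext f p = 0"
  using assms(2)
proof (induction rule: fk_ideal.induct)
  case (gen r a b)
  show ?case
  proof (induction a rule: fa_induct)
    case (single u c)
    show ?case
      by (induction b rule: fa_induct) (simp_all add: fa_ext_rel[OF assms(1) gen] fa_mul_add_right fa_ext_add)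
  qed (simp add: fa_mul_add_left fa_ext_add)
qed (simp_all add: fa_ext_add fa_ext_scale)

text \<open>The choice of representative is immaterial once \<open>f\<close> is compatible; only
  then is the value meaningful.\<close>

definition fk_lift :: "('v word \<Rightarrow> 'v fk) \<Rightarrow> 'v fk \<Rightarrow> 'v fk" where
  "fk_lift f a = fa_ext f (rep_fk a)"

lemma fk_lift_abs:
  assumes "fk_compatible f"
  shows "fk_lift f (abs_fk p) = fa_ext f p"
  using fa_ext_ideal[OF assms rep_abs_fk[of p]] by (simp add: fk_lift_def fa_ext_diff)

lemma fk_lift_mon: "fk_compatible f \<Longrightarrow> fk_lift f (fk_mon w) = f w"
  by (simp add: fk_mon_def fk_lift_abs)

lemma fk_lift_linear:
  assumes "fk_compatible f"
  shows "fk_linear (fk_lift f)"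
proof (rule fk_linearI)
  fix x y :: "'a fk" and c
  obtain p q where [simp]: "x = abs_fk p" "y = abs_fk q" by (metis fk_cases)
  show "fk_lift f (x + y) = fk_lift f x + fk_lift f y"
    by (simp add: abs_fk_add fk_lift_abs[OF assms] fa_ext_add)
  show "fk_lift f (fk_scale c x) = fk_scale c (fk_lift f x)"
    by (simp add: abs_fk_scale fk_lift_abs[OF assms] fa_ext_scale)
qed

text \<open>Formulated for an arbitrary family \<open>G\<close>, so that renamed generators and
  generators cut down to blocks share the computations below.\<close>

definition fk_relations :: "('v \<Rightarrow> 'v \<Rightarrow> 'v fk) \<Rightarrow> bool" where
  "fk_relations G \<longleftrightarrow>
      (\<forall>i j. G i j + G j i = 0)
    \<and> (\<forall>i. G i i = 0)
    \<and> (\<forall>i j. G i j * G i j = 0)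
    \<and> (\<forall>i j k l. distinct [i, j, k, l] \<longrightarrow> G i j * G k l = G k l * G i j)
    \<and> (\<forall>i j k. distinct [i, j, k] \<longrightarrow> G i j * G j k + G j k * G k i + G k i * G i j = 0)"

lemma fk_relationsD:
  assumes "fk_relations G"
  shows "G i j + G j i = 0" "G i i = 0" "G i j * G i j = 0"
    "distinct [i, j, k, l] \<Longrightarrow> G i j * G k l = G k l * G i j"
    "distinct [i, j, k] \<Longrightarrow> G i j * G j k + G j k * G k i + G k i * G i j = 0"
  using assms unfolding fk_relations_def by blast+

lemma fk_relations_gen: "fk_relations (\<lambda>i j. fk_gen (g i) (g j))" if "inj g"
  unfolding fk_relations_def
proof (intro conjI allI impI)
  fix i j k l
  show "fk_gen (g i) (g j) + fk_gen (g j) (g i) = 0"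
    by (simp add: fk_gen_swap[of "g i"])
  show "fk_gen (g i) (g j) * fk_gen (g k) (g l) = fk_gen (g k) (g l) * fk_gen (g i) (g j)"
    if "distinct [i, j, k, l]"
    using that \<open>inj g\<close> by (intro fk_gen_commute) (auto dest: injD)
  show "fk_gen (g i) (g j) * fk_gen (g j) (g k) + fk_gen (g j) (g k) * fk_gen (g k) (g i)
      + fk_gen (g k) (g i) * fk_gen (g i) (g j) = 0" if "distinct [i, j, k]"
    using that \<open>inj g\<close> by (intro fk_gen_triangle) (auto dest: injD)
qed simp_all

text \<open>The relations framed by arbitrary factors and bracketed to the right, the form in which
  they arise when a word is split around one or two letters.\<close>

lemma fk_relations_mult:
  assumes "fk_relations G"
  shows "A * (G i j * B) + A * (G j i * B) = 0" "A * (G i i * B) = 0" "A * (G i j * (G i j * B)) = 0"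
    "distinct [i, j, k, l] \<Longrightarrow> A * (G i j * (G k l * B)) = A * (G k l * (G i j * B))"
    "distinct [i, j, k] \<Longrightarrow> A * (G i j * (G j k * B)) + A * (G j k * (G k i * B)) + A * (G k i * (G i j * B)) = 0"
proof -
  have "A * (G i j * B) + A * (G j i * B) = A * ((G i j + G j i) * B)"
    by (simp add: algebra_simps)
  then show "A * (G i j * B) + A * (G j i * B) = 0"
    by (simp add: fk_relationsD[OF assms])
  show "A * (G i i * B) = 0" by (simp add: fk_relationsD[OF assms])
  have "A * (G i j * (G i j * B)) = A * ((G i j * G i j) * B)" by (simp add: mult.assoc)
  then show "A * (G i j * (G i j * B)) = 0" by (simp add: fk_relationsD[OF assms])
  show "A * (G i j * (G k l * B)) = A * (G k l * (G i j * B))" if "distinct [i, j, k, l]"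
    using fk_relationsD(4)[OF assms that] by (simp add: mult.assoc[symmetric])
  have "A * (G i j * (G j k * B)) + A * (G j k * (G k i * B)) + A * (G k i * (G i j * B))
      = A * ((G i j * G j k + G j k * G k i + G k i * G i j) * B)"
    by (simp add: algebra_simps)
  then show "A * (G i j * (G j k * B)) + A * (G j k * (G k i * B)) + A * (G k i * (G i j * B)) = 0"
    if "distinct [i, j, k]"
    using that by (simp add: fk_relationsD[OF assms])
qed

section \<open>The action of injective vertex maps by algebra endomorphisms\<close>

definition fk_act :: "('v \<Rightarrow> 'v) \<Rightarrow> 'v fk \<Rightarrow> 'v fk" where
  "fk_act g = fk_lift (\<lambda>w. fk_mon (map (map_prod g g) w))"

lemma fk_act_compatible:
  assumes "inj g"
  shows "fk_compatible (\<lambda>w. fk_mon (map (map_prod g g) w))"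
  unfolding fk_compatible_def using fk_relations_mult(1-3,5)[OF fk_relations_gen[OF assms]]
  by (auto simp: fk_mon_append fk_mon_Cons intro: fk_relations_mult(4)[OF fk_relations_gen[OF assms]])

lemma fk_act_mon: "inj g \<Longrightarrow> fk_act g (fk_mon w) = fk_mon (map (map_prod g g) w)"
  by (simp add: fk_act_def fk_lift_mon fk_act_compatible)

lemma fk_act_linear: "inj g \<Longrightarrow> fk_linear (fk_act g)"
  by (simp add: fk_act_def fk_lift_linear fk_act_compatible)

lemmas fk_act_add = module_hom.add[OF fk_act_linear]
  and fk_act_scale = module_hom.scale[OF fk_act_linear]
  and fk_act_zero = module_hom.zero[OF fk_act_linear]
  and fk_act_neg = module_hom.neg[OF fk_act_linear]

lemma fk_act_one: "inj g \<Longrightarrow> fk_act g 1 = 1"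
  using fk_act_mon[of g "[]"] by simp

lemma fk_act_mult:
  assumes "inj g"
  shows "fk_act g (a * b) = fk_act g a * fk_act g b"
proof (induction a rule: fk_induct)
  case (mon u)
  show ?case
    by (induction b rule: fk_induct)
      (simp_all add: fk_mon_append[symmetric] fk_act_mon fk_act_add fk_act_scale assms distrib_left)
qed (simp_all add: fk_act_add fk_act_scale assms distrib_right)

lemma fk_act_gen: "inj g \<Longrightarrow> fk_act g (fk_gen i j) = fk_gen (g i) (g j)"
  using fk_act_mon[of g "[(i, j)]"] by (simp add: fk_mon_Cons)

lemma fk_act_act:
  assumes "inj g" "inj h"
  shows "fk_act g (fk_act h a) = fk_act (g \<circ> h) a"
proof (rule fk_linear_eqI[of "\<lambda>a. fk_act g (fk_act h a)" "fk_act (g \<circ> h)"])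
  have gh: "inj (g \<circ> h)" using assms by (rule inj_compose)
  show "fk_linear (\<lambda>a. fk_act g (fk_act h a))" "fk_linear (fk_act (g \<circ> h))"
    using gh assms by (auto intro!: fk_linearI simp: fk_act_add fk_act_scale)
  show "fk_act g (fk_act h (fk_mon w)) = fk_act (g \<circ> h) (fk_mon w)" for w
    using assms by (simp add: fk_act_mon gh map_prod.comp)
qed

section \<open>Projections to the homogeneous components\<close>

definition fk_proj :: "nat \<Rightarrow> 'v fk \<Rightarrow> 'v fk" where
  "fk_proj d = fk_lift (\<lambda>w. if length w = d then fk_mon w else 0)"

text \<open>All relations are homogeneous: the length test gives the same answer for every word in a
  framed relation.\<close>

lemma fk_proj_compatible: "fk_compatible (\<lambda>w. if length w = d then fk_mon w else 0)"
  unfolding fk_compatible_def using fk_relations_mult(1-3,5)[OF fk_relations_gen[OF inj_on_id]]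
  by (auto simp: fk_mon_append fk_mon_Cons intro: fk_relations_mult(4,5)[OF fk_relations_gen[OF inj_on_id], simplified])

lemma fk_proj_mon: "fk_proj d (fk_mon w) = (if length w = d then fk_mon w else 0)"
  by (simp add: fk_proj_def fk_lift_mon fk_proj_compatible)

lemma fk_proj_linear: "fk_linear (fk_proj d)"
  by (simp add: fk_proj_def fk_lift_linear fk_proj_compatible)

section \<open>Skew derivations relative to a partition of the vertices\<close>

text \<open>The image of a generator under the endomorphism \<pi> that kills \<open>x_{ij}\<close>
  for \<open>i\<close>, \<open>j\<close> in different classes of \<open>R\<close>.\<close>

definition fk_block_gen :: "('v \<Rightarrow> 'v \<Rightarrow> bool) \<Rightarrow> 'v \<Rightarrow> 'v \<Rightarrow> 'v fk" where
  "fk_block_gen R i j = (if R i j then fk_gen i j else 0)"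

text \<open>If two sides of a triangle lie in \<open>R\<close>, so does the third. Hence a triangle
  relation either survives whole or loses all its products.\<close>

lemma fk_relations_block_gen:
  assumes "equivp R"
  shows "fk_relations (fk_block_gen R)"
  unfolding fk_relations_def
proof (intro conjI allI impI)
  have sym: "R i j \<Longrightarrow> R j i" for i j using assms by (rule equivp_symp)
  have trans: "R i j \<Longrightarrow> R j k \<Longrightarrow> R i k" for i j k using assms by (rule equivp_transp)
  fix i j k l
  show "fk_block_gen R i j + fk_block_gen R j i = 0"
    using sym[of i j] sym[of j i] by (auto simp: fk_block_gen_def fk_gen_swap[of i])
  show "fk_block_gen R i j * fk_block_gen R k l = fk_block_gen R k l * fk_block_gen R i j"
    if "distinct [i, j, k, l]"
    using fk_gen_commute[OF that] by (simp add: fk_block_gen_def)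
  show "fk_block_gen R i j * fk_block_gen R j k + fk_block_gen R j k * fk_block_gen R k i
      + fk_block_gen R k i * fk_block_gen R i j = 0" if "distinct [i, j, k]"
  proof (cases "R i j \<and> R j k \<or> R j k \<and> R k i \<or> R k i \<and> R i j")
    case True
    then have "R i j" "R j k" "R k i" using sym trans by blast+
    then show ?thesis using fk_gen_triangle[OF that] by (simp add: fk_block_gen_def)
  qed (auto simp: fk_block_gen_def)
qed (simp_all add: fk_block_gen_def)

text \<open>The value of \<open>D_l\<close> on a word. The first letter goes to the left tensor
  factor or to the right one; in the second case it passes the left factor, on which it acts as a
  transposition, and its image under \<pi> is absorbed into the functional.\<close>

fun fk_skew :: "('v \<Rightarrow> 'v \<Rightarrow> bool) \<Rightarrow> 'v word \<Rightarrow> ('v fk \<Rightarrow> rat) \<Rightarrow> 'v fk" where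
  "fk_skew R [] l = fk_scale (l 1) 1"
| "fk_skew R ((i, j) # w) l = fk_gen i j * fk_skew R w l
     + fk_act (transpose i j) (fk_skew R w (\<lambda>v. l (fk_block_gen R i j * v)))"

lemma fk_skew_add: "fk_skew R w (\<lambda>v. l v + m v) = fk_skew R w l + fk_skew R w m"
  by (induction w arbitrary: l m) (auto simp: fk.scale_left_distrib fk_act_add algebra_simps)

lemma fk_skew_zero [simp]: "fk_skew R w (\<lambda>v. 0) = 0"
  using fk_skew_add[of R w "\<lambda>v. 0" "\<lambda>v. 0"] by simp

lemma fk_skew_neg: "fk_skew R w (\<lambda>v. - l v) = - fk_skew R w l"
  using fk_skew_add[of R w l "\<lambda>v. - l v"] by (simp add: eq_neg_iff_add_eq_0 add.commute)

lemma fk_functional_mult: "fk_functional l \<Longrightarrow> fk_functional (\<lambda>v. l (a * v))"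
  by (rule fk_functionalI) (simp_all add: distrib_left module_hom.add module_hom.scale)

text \<open>Two steps of the recursion, with the outer transposition pushed past the second letter.
  The four terms record which of the two letters go left and which go right; the quadratic relations
  are checked against them.\<close>

lemma fk_skew_pair: "fk_skew R ((i, j) # (k, m) # w) l =
    fk_gen i j * (fk_gen k m * fk_skew R w l)
  + fk_gen i j * fk_act (transpose k m) (fk_skew R w (\<lambda>v. l (fk_block_gen R k m * v)))
  + fk_gen (transpose i j k) (transpose i j m)
      * fk_act (transpose i j) (fk_skew R w (\<lambda>v. l (fk_block_gen R i j * v)))
  + fk_act (transpose i j \<circ> transpose k m)
      (fk_skew R w (\<lambda>v. l (fk_block_gen R i j * (fk_block_gen R k m * v))))"
  by (simp add: fk_act_add fk_act_mult fk_act_gen fk_act_act algebra_simps)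

text \<open>Each relation is proved by induction on the prefix \<open>u\<close>, for all linear
  functionals at once: a letter of \<open>u\<close> only applies linear maps and changes the
  functional. The content is the empty prefix. There the terms with all letters left vanish by the
  relations of the generators, those with all letters right by the relations of the block
  generators, and mixed terms cancel or match each other.\<close>

lemma fk_skew_compatible:
  assumes R: "equivp R" and l: "fk_functional l"
  shows "fk_compatible (\<lambda>w. fk_skew R w l)"
proof -
  \<comment> \<open>\<open>rel\<close> is applied inside the functionals, \<open>relg\<close> to the
    left tensor factor.\<close>
  note rel = fk_relations_mult[OF fk_relations_block_gen[OF R], where A = 1, unfolded mult_1_left id_apply]
  note relg = fk_relations_mult[OF fk_relations_gen[OF inj_on_id], where A = 1, unfolded mult_1_left id_apply]
  have swap: "fk_skew R (u @ (i, j) # v) l + fk_skew R (u @ (j, i) # v) l = 0"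
    if "fk_functional l" for u v i j l
    using that
  proof (induction u arbitrary: l)
    case Nil
    have "(\<lambda>w. l (fk_block_gen R j i * w)) = (\<lambda>w. - l (fk_block_gen R i j * w))"
      using rel(1)[where i = i and j = j] module_hom.add[OF Nil] module_hom.zero[OF Nil]
      by (metis eq_neg_iff_add_eq_0 add.commute)
    then show ?case
      by (simp add: fk_skew_neg fk_act_neg transpose_commute[of j i] fk_gen_swap[of j i])
  next
    case (Cons x u)
    obtain a b where x: "x = (a, b)" by fastforce
    show ?case
      using Cons.IH[OF Cons.prems] Cons.IH[OF fk_functional_mult[OF Cons.prems, of "fk_block_gen R a b"]]
      by (simp add: x eq_neg_iff_add_eq_0[symmetric] fk_act_neg)
  qed
  have self: "fk_skew R (u @ (i, i) # v) l = 0" if "fk_functional l" for u v i l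
    using that
  proof (induction u arbitrary: l)
    case Nil
    then show ?case by (simp add: fk_block_gen_def module_hom.zero fk_act_zero)
  next
    case (Cons x u)
    then show ?case by (cases x) (simp add: fk_functional_mult fk_act_zero)
  qed
  have square: "fk_skew R (u @ (i, j) # (i, j) # v) l = 0" if "fk_functional l" for u v i j l
    using that
  proof (induction u arbitrary: l)
    case Nil
    then show ?case
      unfolding append.simps fk_skew_pair
      by (simp add: rel relg module_hom.zero fk_act_zero fk_gen_swap[of j i])
  next
    case (Cons x u)
    then show ?case
      by (cases x) (simp add: fk_functional_mult fk_act_zero del: fk_skew.simps(2) add: fk_skew.simps(2)[of R _ _ "u @ _"])
  qed
  have comm: "fk_skew R (u @ (i, j) # (k, m) # v) l = fk_skew R (u @ (k, m) # (i, j) # v) l"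
    if "fk_functional l" "distinct [i, j, k, m]" for u v i j k m l
    using that(1)
  proof (induction u arbitrary: l)
    case Nil
    \<comment> \<open>Disjoint transpositions commute and fix each other's letters, so the mixed
      terms of the two words match crosswise.\<close>
    have "transpose i j \<circ> transpose k m = transpose k m \<circ> transpose i j"
        "transpose i j k = k" "transpose i j m = m" "transpose k m i = i" "transpose k m j = j"
      using that(2) by (auto simp: fun_eq_iff transpose_def)
    then show ?case
      unfolding append.simps fk_skew_pair
      using that(2) rel(4)[OF that(2)] relg(4)[OF that(2)] by simp
  next
    case (Cons x u)
    then show ?case
      by (cases x) (simp add: fk_functional_mult del: fk_skew.simps(2) add: fk_skew.simps(2)[of R _ _ "u @ _"])
  qed
  have tri: "fk_skew R (u @ (i, j) # (j, k) # v) l + fk_skew R (u @ (j, k) # (k, i) # v) l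
      + fk_skew R (u @ (k, i) # (i, j) # v) l = 0"
    if "fk_functional l" "distinct [i, j, k]" for u v i j k l
    using that(1)
  proof (induction u arbitrary: l)
    case Nil
    let ?P = "fk_block_gen R"
    \<comment> \<open>All three products of transpositions are the same 3-cycle, so the terms with
      both letters right add up under a single action.\<close>
    define s where "s = transpose i j \<circ> transpose j k"
    have s: "transpose i j \<circ> transpose j k = s" "transpose j k \<circ> transpose k i = s"
        "transpose k i \<circ> transpose i j = s" and "inj s"
      using that(2) by (auto simp: s_def fun_eq_iff transpose_def intro: inj_compose)
    have "(\<lambda>w. l (?P i j * (?P j k * w)) + l (?P j k * (?P k i * w)) + l (?P k i * (?P i j * w))) = (\<lambda>w. 0)"
      using rel(5)[OF that(2)] by (simp add: module_hom.add[OF Nil, symmetric] module_hom.zero[OF Nil])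
    then have "fk_skew R v (\<lambda>w. l (?P i j * (?P j k * w))) + fk_skew R v (\<lambda>w. l (?P j k * (?P k i * w)))
        + fk_skew R v (\<lambda>w. l (?P k i * (?P i j * w))) = 0"
      by (simp add: fk_skew_add[symmetric])
    then have "fk_act s (fk_skew R v (\<lambda>w. l (?P i j * (?P j k * w))))
        + fk_act s (fk_skew R v (\<lambda>w. l (?P j k * (?P k i * w))))
        + fk_act s (fk_skew R v (\<lambda>w. l (?P k i * (?P i j * w)))) = 0"
      using \<open>inj s\<close> by (simp add: fk_act_add[symmetric] fk_act_zero)
    \<comment> \<open>These values make the second mixed term of each word the negative of the first
      mixed term of another word.\<close>
    moreover have "transpose i j j = i" "transpose i j k = k" "transpose j k k = j" "transpose j k i = i"
        "transpose k i i = k" "transpose k i j = j"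
      using that(2) by (auto simp: transpose_def)
    ultimately show ?case
      unfolding append.simps fk_skew_pair s
      using relg(5)[OF that(2), where B = "fk_skew R v l"]
      by (simp add: fk_gen_swap[of j i] fk_gen_swap[of k j] fk_gen_swap[of i k] algebra_simps)
  next
    case (Cons x u)
    obtain a b where x: "x = (a, b)" by fastforce
    have "fk_gen a b * (fk_skew R (u @ (i, j) # (j, k) # v) l + fk_skew R (u @ (j, k) # (k, i) # v) l
      + fk_skew R (u @ (k, i) # (i, j) # v) l) = 0" using Cons by simp
    moreover define l' where "l' = (\<lambda>v. l (fk_block_gen R a b * v))"
    have "fk_act (transpose a b) (fk_skew R (u @ (i, j) # (j, k) # v) l' + fk_skew R (u @ (j, k) # (k, i) # v) l'
      + fk_skew R (u @ (k, i) # (i, j) # v) l') = 0"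
      using Cons.IH[of l'] by (simp add: l'_def fk_functional_mult Cons.prems fk_act_zero)
    ultimately show ?case
      by (simp add: x l'_def[symmetric] fk_act_add algebra_simps del: fk_skew.simps(2) add: fk_skew.simps(2)[of R _ _ "u @ _"])
  qed
  show ?thesis
    unfolding fk_compatible_def
    by (intro allI conjI impI swap[OF l] self[OF l] square[OF l] comm[OF l] tri[OF l])
qed

definition fk_D :: "('v \<Rightarrow> 'v \<Rightarrow> bool) \<Rightarrow> ('v fk \<Rightarrow> rat) \<Rightarrow> 'v fk \<Rightarrow> 'v fk" where
  "fk_D R l = fk_lift (\<lambda>w. fk_skew R w l)"

lemma fk_D_linear: "equivp R \<Longrightarrow> fk_functional l \<Longrightarrow> fk_linear (fk_D R l)"
  by (simp add: fk_D_def fk_lift_linear fk_skew_compatible)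

lemma fk_D_mon: "equivp R \<Longrightarrow> fk_functional l \<Longrightarrow> fk_D R l (fk_mon w) = fk_skew R w l"
  by (simp add: fk_D_def fk_lift_mon fk_skew_compatible)

lemma fk_D_gen_mult:
  assumes "equivp R" "fk_functional l"
  shows "fk_D R l (fk_gen i j * a) = fk_gen i j * fk_D R l a
    + fk_act (transpose i j) (fk_D R (\<lambda>v. l (fk_block_gen R i j * v)) a)"
proof (induction a rule: fk_induct)
  case (mon w)
  show ?case
    using assms by (simp add: fk_mon_Cons[symmetric] fk_D_mon fk_functional_mult)
qed (simp_all add: distrib_left module_hom.add[OF fk_D_linear] module_hom.scale[OF fk_D_linear]
      assms fk_functional_mult fk_act_add fk_act_scale fk.scale_right_distrib)

section \<open>Subalgebras of graphs and the grading\<close>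

lemma fk_span_mult:
  assumes "a \<in> fk.span S" "b \<in> fk.span T" "fk.subspace X" "\<And>s t. s \<in> S \<Longrightarrow> t \<in> T \<Longrightarrow> s * t \<in> X"
  shows "a * b \<in> X"
  using assms(1)
proof (induction rule: fk.span_induct)
  case base
  show ?case
    using assms(3) by (auto simp: fk.subspace_def distrib_right)
next
  case (step s)
  show ?case using assms(2)
  proof (induction rule: fk.span_induct)
    case base
    show ?case using assms(3) by (auto simp: fk.subspace_def distrib_left)
  qed (use step assms(4) in simp)
qed

definition fk_words :: "('v \<Rightarrow> 'v \<Rightarrow> bool) \<Rightarrow> 'v word set" where
  "fk_words E = {w. \<forall>(i, j)\<in>set w. E i j}"

lemma fk_words_simps [simp]: "[] \<in> fk_words E" "(i, j) # w \<in> fk_words E \<longleftrightarrow> E i j \<and> w \<in> fk_words E"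
    "u @ v \<in> fk_words E \<longleftrightarrow> u \<in> fk_words E \<and> v \<in> fk_words E"
  by (auto simp: fk_words_def)

lemma fk_subspace_fkG: "fk.subspace (fkG E)"
  using fk_subalg.scale[OF fk_subalg.one, of 0]
  by (simp add: fk.subspace_def fkG_def fk_subalg.add fk_subalg.scale)

lemma fk_mon_in_fkG: "w \<in> fk_words E \<Longrightarrow> fk_mon w \<in> fkG E"
  by (induction w) (auto simp: fkG_def fk_mon_Cons intro!: fk_subalg.one fk_subalg.mul fk_subalg.gen)

text \<open>Monomials multiply by concatenation of words, so the span of the words in the edges is
  already closed under products.\<close>

lemma fkG_eq_span: "fkG E = fk.span (fk_mon ` fk_words E)"
proof
  show "fk.span (fk_mon ` fk_words E) \<subseteq> fkG E"
    by (intro fk.span_minimal fk_subspace_fkG) (auto intro: fk_mon_in_fkG)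
  show "fkG E \<subseteq> fk.span (fk_mon ` fk_words E)"
  proof
    fix a assume "a \<in> fkG E"
    then show "a \<in> fk.span (fk_mon ` fk_words E)"
      unfolding fkG_def
    proof (induction rule: fk_subalg.induct)
      case one
      have "fk_mon [] \<in> fk.span (fk_mon ` fk_words E)" by (intro fk.span_base imageI) simp
      then show ?case by simp
    next
      case (gen i j)
      then have "fk_mon [(i, j)] \<in> fk.span (fk_mon ` fk_words E)" by (intro fk.span_base imageI) simp
      then show ?case by (simp add: fk_mon_Cons)
    next
      case (mul a b)
      show ?case
        by (rule fk_span_mult[OF mul.IH fk.subspace_span])
          (auto simp: fk_mon_append[symmetric] intro!: fk.span_base)
    qed (auto intro: fk.span_add fk.span_scale)
  qed
qed

lemma fkG_mono: "(\<And>i j. E i j \<Longrightarrow> E' i j) \<Longrightarrow> fkG E \<subseteq> fkG E'"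
  unfolding fkG_eq_span by (intro fk.span_mono image_mono) (auto simp: fk_words_def)

lemma fkG_mult: "a \<in> fkG E \<Longrightarrow> b \<in> fkG E \<Longrightarrow> a * b \<in> fkG E"
  by (simp add: fkG_def fk_subalg.mul)

lemma fkG_gen: "E i j \<Longrightarrow> fk_gen i j \<in> fkG E"
  by (simp add: fkG_def fk_subalg.gen)

lemma fkG_one: "1 \<in> fkG E"
  by (simp add: fkG_def fk_subalg.one)

section \<open>The grading by word length\<close>

lemma fk_subspace_deg: "fk.subspace (fk_deg d :: 'v fk set)"
  unfolding fk.subspace_def fk_deg_def
proof (intro conjI ballI allI)
  show "0 \<in> {abs_fk p |p. \<forall>w\<in>Poly_Mapping.keys p. length w = d}"
    by (auto simp: zero_fk.abs_eq intro!: exI[of _ 0])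
next
  fix x y :: "'v fk" assume "x \<in> {abs_fk p |p. \<forall>w\<in>Poly_Mapping.keys p. length w = d}"
    "y \<in> {abs_fk p |p. \<forall>w\<in>Poly_Mapping.keys p. length w = d}"
  then obtain p q where "x = abs_fk p" "y = abs_fk q"
    and pq: "\<forall>w\<in>Poly_Mapping.keys p. length w = d" "\<forall>w\<in>Poly_Mapping.keys q. length w = d" by blast
  moreover have "\<forall>w\<in>Poly_Mapping.keys (p + q). length w = d"
    using pq Poly_Mapping.keys_add[of p q] by blast
  ultimately show "x + y \<in> {abs_fk p |p. \<forall>w\<in>Poly_Mapping.keys p. length w = d}"
    by (auto simp: abs_fk_add)
next
  fix c and x :: "'v fk" assume "x \<in> {abs_fk p |p. \<forall>w\<in>Poly_Mapping.keys p. length w = d}"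
  then obtain p where "x = abs_fk p" and p: "\<forall>w\<in>Poly_Mapping.keys p. length w = d" by blast
  moreover have "\<forall>w\<in>Poly_Mapping.keys (fa_scale c p). length w = d"
    using p by (auto simp: in_keys_iff)
  ultimately show "fk_scale c x \<in> {abs_fk p |p. \<forall>w\<in>Poly_Mapping.keys p. length w = d}"
    by (auto simp: abs_fk_scale)
qed

lemma fk_mon_deg: "fk_mon w \<in> fk_deg (length w)"
  by (auto simp: fk_deg_def fk_mon_def intro!: exI[of _ "Poly_Mapping.single w 1"])

lemma fk_deg_eq_span: "(fk_deg d :: 'v fk set) = fk.span (fk_mon ` {w. length w = d})"
proof
  show "fk_deg d \<subseteq> fk.span (fk_mon ` {w. length w = d})"
  proof
    fix a assume "a \<in> fk_deg d"
    then obtain p where p: "a = abs_fk p" "\<forall>w\<in>Poly_Mapping.keys p. length w = d"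
      by (auto simp: fk_deg_def)
    have "fk_mon ` Poly_Mapping.keys p \<subseteq> fk_mon ` {w. length w = d}" using p by auto
    then show "a \<in> fk.span (fk_mon ` {w. length w = d})"
      using fk_span_mon_keys[of p] fk.span_mono p(1) by blast
  qed
  show "fk.span (fk_mon ` {w. length w = d}) \<subseteq> fk_deg d"
    by (intro fk.span_minimal fk_subspace_deg) (auto intro: fk_mon_deg)
qed

lemma fk_proj_deg: "a \<in> fk_deg e \<Longrightarrow> fk_proj d a = (if e = d then a else 0)"
  unfolding fk_deg_eq_span
proof (induction rule: fk.span_induct)
  case base
  show ?case
    by (auto simp: fk.subspace_def module_hom.add[OF fk_proj_linear]
        module_hom.scale[OF fk_proj_linear] module_hom.zero[OF fk_proj_linear])
qed (auto simp: fk_proj_mon)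

lemma fk_deg_unique: "a \<in> fk_deg d \<Longrightarrow> a \<in> fk_deg e \<Longrightarrow> a \<noteq> 0 \<Longrightarrow> d = e"
  using fk_proj_deg[of a d d] fk_proj_deg[of a e d] by (auto split: if_splits)

lemma fk_deg_mult: "a \<in> fk_deg d \<Longrightarrow> b \<in> fk_deg e \<Longrightarrow> a * b \<in> fk_deg (d + e)"
  unfolding fk_deg_eq_span
  by (erule (1) fk_span_mult[OF _ _ fk.subspace_span])
    (auto simp: fk_mon_append[symmetric] intro!: fk.span_base)

text \<open>The projection to degree \<open>d\<close> fixes or kills each element of
  \<open>C\<close>. It therefore maps the span of \<open>C\<close> into the span of the
  degree-\<open>d\<close> elements of \<open>C\<close>, which form a basis of the
  degree-\<open>d\<close> part.\<close>

lemma fk_dim_homogeneous: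
  assumes "fk.independent C" "\<And>c. c \<in> C \<Longrightarrow> \<exists>e. c \<in> fk_deg e"
  shows "fk.dim (fk.span C \<inter> fk_deg d) = card (C \<inter> fk_deg d)"
proof (rule fk.basis_card_eq_dim[symmetric])
  show "C \<inter> fk_deg d \<subseteq> fk.span C \<inter> fk_deg d" by (auto intro: fk.span_base)
  show "fk.independent (C \<inter> fk_deg d)" using assms(1) by (rule fk.independent_mono) auto
  have "fk_proj d v \<in> fk.span (C \<inter> fk_deg d)" if "v \<in> fk.span C" for v
    using that
  proof (induction rule: fk.span_induct)
    case base
    show ?case
      by (auto simp: fk.subspace_def module_hom.add[OF fk_proj_linear] fk.span_zero
        module_hom.scale[OF fk_proj_linear] module_hom.zero[OF fk_proj_linear]
        intro: fk.span_add fk.span_scale)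
  next
    case (step c)
    then obtain e where "c \<in> fk_deg e" using assms(2) by blast
    then show ?case using step by (auto simp: fk_proj_deg fk.span_zero intro: fk.span_base)
  qed
  then show "fk.span C \<inter> fk_deg d \<subseteq> fk.span (C \<inter> fk_deg d)"
    using fk_proj_deg by force
qed

section \<open>Factorization of a graph algebra\<close>

text \<open>As \<open>E2\<close> is symmetric, its reflexive transitive closure is the relation of
  lying in the same component of G_2.\<close>

locale fk_split =
  fixes E1 E2 :: "'v \<Rightarrow> 'v \<Rightarrow> bool"
  assumes sym1: "E1 i j \<Longrightarrow> E1 j i" and sym2: "E2 i j \<Longrightarrow> E2 j i"
    and irrefl1: "\<not> E1 i i" and irrefl2: "\<not> E2 i i"
    and disjoint: "\<not> (E1 i j \<and> E2 i j)"
    and modular: "E2\<^sup>*\<^sup>* j k \<Longrightarrow> i \<noteq> j \<Longrightarrow> i \<noteq> k \<Longrightarrow> E1 i j \<longleftrightarrow> E1 i k"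
begin

lemma equivp_component: "equivp E2\<^sup>*\<^sup>*"
proof (rule equivpI)
  have "symp E2" using sym2 by (auto intro: sympI)
  then show "symp E2\<^sup>*\<^sup>*" by (rule symp_rtranclp)
qed (auto intro: reflpI transpI)

text \<open>Along a path of G_2 starting at \<open>i\<close>, \<open>modular\<close> passes
  non-adjacency to \<open>i\<close> in G_1 from each vertex to the next. If one of the two is
  \<open>i\<close> itself, disjointness or irreflexivity applies instead.\<close>

lemma component_not_E1: "E2\<^sup>*\<^sup>* i j \<Longrightarrow> \<not> E1 i j"
proof (induction rule: rtranclp_induct)
  case base
  show ?case by (rule irrefl1)
next
  case (step y z)
  then show ?case
    using irrefl1[of i] disjoint[of i z] modular[OF r_into_rtranclp[of E2 y z], of i]
    by (cases "i = y"; cases "i = z") auto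
qed

section \<open>The operators \<open>D l\<close> on products, and injectivity\<close>

abbreviation "D \<equiv> fk_D E2\<^sup>*\<^sup>*"

lemmas D_linear = fk_D_linear[OF equivp_component]

text \<open>No edge of G_1 lies inside a component of G_2, so \<pi> kills every letter of
  \<open>a\<close> and only the first term of the recursion survives.\<close>

lemma D_mult_left:
  assumes "fk_functional l" "a \<in> fkG E1"
  shows "D l (a * b) = a * D l b"
  using assms(2) unfolding fkG_eq_span
proof (induction rule: fk.span_induct)
  case base
  show ?case
    by (auto simp: fk.subspace_def distrib_right module_hom.add[OF D_linear[OF assms(1)]]
        module_hom.scale[OF D_linear[OF assms(1)]] module_hom.zero[OF D_linear[OF assms(1)]])
next
  case (step s)
  then obtain w where "s = fk_mon w" "w \<in> fk_words E1" by blast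
  moreover from this(2) have "D l (fk_mon w * b) = fk_mon w * D l b"
  proof (induction w)
    case (Cons x w)
    obtain i j where x: "x = (i, j)" by fastforce
    have "fk_block_gen E2\<^sup>*\<^sup>* i j = 0" using Cons.prems x component_not_E1 by (auto simp: fk_block_gen_def)
    moreover have zero: "fk_functional (\<lambda>v. 0)" by (rule fk_functionalI) auto
    \<comment> \<open>The second term of the recursion carries the zero functional, and its operator
      vanishes.\<close>
    have "D (\<lambda>v. 0) c = 0" for c
      by (rule fk_linear_eqI[of "D (\<lambda>v. 0)" "\<lambda>_. 0"])
        (simp_all add: zero D_linear fk_linearI fk_D_mon equivp_component)
    ultimately show ?case
      using Cons x
      by (simp add: fk_mon_Cons mult.assoc fk_D_gen_mult[OF equivp_component assms(1)]
          module_hom.zero[OF assms(1)] fk_act_zero)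
  qed simp
  ultimately show ?case by simp
qed

text \<open>Since \<open>l\<close> vanishes on shorter words, a term survives only if every letter
  goes to the right factor. The left factor is then 1, which all transpositions fix.\<close>

lemma D_mon_right:
  assumes "fk_functional l" "w \<in> fk_words E2" "\<And>u. length u < length w \<Longrightarrow> l (fk_mon u) = 0"
  shows "D l (fk_mon w) = fk_scale (l (fk_mon w)) 1"
  using assms
proof (induction w arbitrary: l)
  case Nil
  then show ?case using fk_D_mon[OF equivp_component Nil(1), of "[]"] by simp
next
  case (Cons x w)
  obtain i j where x: "x = (i, j)" by fastforce
  have blk: "fk_block_gen E2\<^sup>*\<^sup>* i j = fk_gen i j" using Cons.prems x by (auto simp: fk_block_gen_def)
  have "D l (fk_mon w) = fk_scale (l (fk_mon w)) 1"
    using Cons.prems x by (intro Cons.IH) auto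
  then have 1: "D l (fk_mon w) = 0" using Cons.prems(3)[of w] by simp
  have 2: "D (\<lambda>v. l (fk_gen i j * v)) (fk_mon w) = fk_scale (l (fk_gen i j * fk_mon w)) 1"
    using Cons.prems x by (intro Cons.IH) (auto simp: fk_functional_mult fk_mon_Cons[symmetric])
  show ?case
    by (simp add: x fk_mon_Cons fk_D_gen_mult[OF equivp_component Cons.prems(1)] blk 1 2
        fk_act_scale fk_act_one)
qed

text \<open>Linear independence over the rationals is upgraded to independence over E_{G_1}. The
  basis word \<open>wd b0\<close> is taken of maximal length among those with nonzero coefficient,
  so that \<open>D_mon_right\<close> applies to every remaining term.\<close>

lemma left_coefficients_zero:
  assumes B: "fk.independent B" "B \<subseteq> fk_mon ` fk_words E2"
    and F: "finite F" "F \<subseteq> B" and \<alpha>: "\<And>b. b \<in> F \<Longrightarrow> \<alpha> b \<in> fkG E1"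
    and sum: "(\<Sum>b\<in>F. \<alpha> b * b) = 0" and b: "b \<in> F"
  shows "\<alpha> b = 0"
proof (rule ccontr)
  assume "\<alpha> b \<noteq> 0"
  define Z where "Z = {b\<in>F. \<alpha> b \<noteq> 0}"
  have "\<forall>b\<in>B. \<exists>w\<in>fk_words E2. b = fk_mon w" using B by blast
  then obtain wd where wd: "\<And>b. b \<in> B \<Longrightarrow> wd b \<in> fk_words E2 \<and> b = fk_mon (wd b)" by metis
  have "finite Z" "Z \<noteq> {}" using F b \<open>\<alpha> b \<noteq> 0\<close> by (auto simp: Z_def)
  then obtain b0 where b0: "b0 \<in> Z" and max: "\<And>b. b \<in> Z \<Longrightarrow> length (wd b) \<le> length (wd b0)"
    using Max_in[of "(length \<circ> wd) ` Z"] Max_ge[of "(length \<circ> wd) ` Z"] by fastforce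
  define d where "d = length (wd b0)"
  \<comment> \<open>\<open>l\<close> reads off the coefficient of \<open>b0\<close> in degree \<open>d\<close>, so that \<open>D l\<close> isolates \<open>\<alpha> b0\<close>.\<close>
  let ?B = "fk.extend_basis B"
  define l where "l v = fk.representation ?B (fk_proj d v) b0" for v
  \<comment> \<open>Linearity on the whole algebra needs coordinates for every element, hence the
    extension of \<open>B\<close> to a full basis.\<close>
  have l: "fk_functional l"
    by (rule fk_functionalI)
      (simp_all add: l_def module_hom.add[OF fk_proj_linear] module_hom.scale[OF fk_proj_linear]
        fk.representation_add fk.representation_scale fk.independent_extend_basis B fk.span_extend_basis)
  have B0: "Z \<subseteq> B" "b0 \<in> B" using b0 F by (auto simp: Z_def)
  have l_mon: "l (fk_mon u) = 0" if "length u < d" for u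
    using that by (simp add: l_def fk_proj_mon fk.representation_zero)
  have l_Z: "l b = (if b = b0 then 1 else 0)" if "b \<in> Z" for b
  proof (cases "length (wd b) = d")
    case True
    have "b = fk_mon (wd b)" using wd that B0 by blast
    then have "fk_proj d b = b" using True fk_proj_mon[of d "wd b"] by simp
    moreover have "b \<in> ?B" using fk.extend_basis_superset[OF B(1)] that B0 by blast
    ultimately show ?thesis
      using fk.representation_basis[OF fk.independent_extend_basis[OF B(1)], of b] by (simp add: l_def)
  next
    case False
    have "b = fk_mon (wd b)" using wd that B0 by blast
    then have "fk_proj d b = 0" using False fk_proj_mon[of d "wd b"] by simp
    then show ?thesis using False by (auto simp: l_def fk.representation_zero d_def)
  qed
  have "D l (\<alpha> b * b) = (if b = b0 then \<alpha> b0 else 0)" if "b \<in> F" for b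
  proof (cases "b \<in> Z")
    case True
    have w: "wd b \<in> fk_words E2" "b = fk_mon (wd b)" using wd B0 True by auto
    have "D l (fk_mon (wd b)) = fk_scale (l (fk_mon (wd b))) 1"
      using l_mon max[OF True] w by (intro D_mon_right l) (auto simp: d_def)
    then have "D l b = fk_scale (l b) 1" using w by simp
    then show ?thesis
      using D_mult_left[OF l \<alpha>[OF that], of b] l_Z[OF True] by simp
  next
    case False
    then show ?thesis
      using that b0 by (auto simp: Z_def module_hom.zero[OF D_linear[OF l]])
  qed
  then have "D l (\<Sum>b\<in>F. \<alpha> b * b) = (\<Sum>b\<in>F. if b = b0 then \<alpha> b0 else 0)"
    by (simp add: module_hom.sum[OF D_linear[OF l]])
  also have "\<dots> = \<alpha> b0" using b0 F by (simp add: Z_def)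
  finally show False using sum b0 by (simp add: Z_def module_hom.zero[OF D_linear[OF l]])
qed

section \<open>Surjectivity: products span the algebra of the union\<close>

definition products :: "'v fk set" where
  "products = fk.span {a * b | a b. a \<in> fkG E1 \<and> b \<in> fkG E2}"

lemma subspace_products: "fk.subspace products"
  unfolding products_def by (rule fk.subspace_span)

lemma mult_in_products: "a \<in> fkG E1 \<Longrightarrow> b \<in> fkG E2 \<Longrightarrow> a * b \<in> products"
  unfolding products_def by (rule fk.span_base) blast

lemma products_left_E1:
  assumes "z \<in> products" "a \<in> fkG E1"
  shows "a * z \<in> products"
  using assms(1) unfolding products_def
proof (induction rule: fk.span_induct)
  case base
  show ?case
    using subspace_products unfolding products_def by (auto simp: fk.subspace_def distrib_left)
next
  case (step z)
  then obtain b c where "z = b * c" "b \<in> fkG E1" "c \<in> fkG E2" by blast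
  then show ?case
    using mult_in_products[OF fkG_mult[OF assms(2)]] by (simp add: mult.assoc[symmetric] products_def)
qed

text \<open>Moves \<open>x_{jk}\<close> past a letter of G_1 sharing a vertex with it. After the
  rewriting each term begins with a letter of G_1, which \<open>products_left_E1\<close> admits, and
  what follows lies in \<open>products\<close>.\<close>

lemma products_left_triangle:
  assumes "E2 j k" "E1 k i" "fk_gen j k * z \<in> products" "z \<in> products"
  shows "fk_gen j k * (fk_gen k i * z) \<in> products"
proof -
  have ne: "i \<noteq> j" "j \<noteq> k" "i \<noteq> k"
    using assms(1,2) irrefl1 irrefl2 disjoint sym1 by blast+
  have "E1 i k" using assms(2) by (rule sym1)
  \<comment> \<open>The edge {j,k} of G_2 lets \<open>modular\<close> carry the edge from
    \<open>k\<close> over to \<open>j\<close>.\<close>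
  then have ij: "E1 i j" using modular[OF r_into_rtranclp[of E2, OF assms(1)]] ne by blast
  have "fk_gen i j * fk_gen j k + fk_gen j k * fk_gen k i + fk_gen k i * fk_gen i j = 0"
    using ne by (intro fk_gen_triangle) auto
  then have "(fk_gen i j * fk_gen j k + fk_gen j k * fk_gen k i + fk_gen k i * fk_gen i j) * z = 0"
    by simp
  then have "fk_gen j k * (fk_gen k i * z)
      = - (fk_gen i j * (fk_gen j k * z) + fk_gen k i * (fk_gen i j * z))"
    by (simp add: algebra_simps eq_neg_iff_add_eq_0)
  also have "\<dots> \<in> products"
    using assms(3,4) fkG_gen[of E1, OF assms(2)] fkG_gen[of E1, OF ij] products_left_E1
    by (intro fk.subspace_neg fk.subspace_add subspace_products) blast+
  finally show ?thesis .
qed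

text \<open>Induction on a word of G_1: \<open>x_{jk}\<close> travels rightwards through it until it
  is absorbed by the factor from E_{G_2}.\<close>

lemma products_left_E2:
  assumes "E2 j k" "z \<in> products"
  shows "fk_gen j k * z \<in> products"
proof -
  have "fk_gen j k * (fk_mon w * b) \<in> products" if "w \<in> fk_words E1" "b \<in> fkG E2" for w b
    using that(1)
  proof (induction w)
    case Nil
    show ?case
      using mult_in_products[OF fkG_one fkG_mult[OF fkG_gen[of E2, OF assms(1)] that(2)]] by simp
  next
    case (Cons x w)
    obtain p q where x: "x = (p, q)" by fastforce
    let ?z = "fk_mon w * b"
    have pq: "E1 p q" "E1 q p" "p \<noteq> q" and jk: "E2 j k" "E2 k j" "j \<noteq> k"
      using Cons.prems x sym1 assms(1) sym2 irrefl1 irrefl2 by auto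
    have IH: "fk_gen j k * ?z \<in> products" using Cons x by auto
    then have IH': "fk_gen k j * ?z \<in> products"
      using fk.subspace_neg[OF subspace_products IH] by (simp add: fk_gen_swap[of k j])
    have z: "?z \<in> products"
      using Cons.prems x that(2) by (intro mult_in_products fk_mon_in_fkG) auto
    have "fk_gen j k * (fk_gen p q * ?z) \<in> products"
    proof -
      \<comment> \<open>If the two edges share a vertex, sign changes bring the product into the
        form of \<open>products_left_triangle\<close>; otherwise the two generators commute.\<close>
      consider "p = k" | "q = k" | "p = j" | "q = j" | "distinct [j, k, p, q]" using pq jk by auto
      then show ?thesis
      proof cases
        case 1
        then show ?thesis using products_left_triangle[of j k q ?z] jk pq IH z by simp
      next
        case 2
        then show ?thesis
          using fk.subspace_neg[OF subspace_products products_left_triangle[of j k p ?z]] jk pq IH z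
          by (simp add: fk_gen_swap[of p k])
      next
        case 3
        then show ?thesis
          using fk.subspace_neg[OF subspace_products products_left_triangle[of k j q ?z]] jk pq IH' z
          by (simp add: fk_gen_swap[of j k])
      next
        case 4
        then show ?thesis
          using products_left_triangle[of k j p ?z] jk pq IH' z
          by (simp add: fk_gen_swap[of j k] fk_gen_swap[of p j])
      next
        case 5
        then have "fk_gen j k * (fk_gen p q * ?z) = fk_gen p q * (fk_gen j k * ?z)"
          using fk_gen_commute by (metis mult.assoc)
        then show ?thesis using products_left_E1[OF IH fkG_gen[of E1 p q]] pq by simp
      qed
    qed
    then show ?case by (simp add: x fk_mon_Cons mult.assoc)
  qed
  note mon = this
  have "fk_gen j k * (a * b) \<in> products" if "a \<in> fkG E1" "b \<in> fkG E2" for a b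
    using that(1) unfolding fkG_eq_span
  proof (induction rule: fk.span_induct)
    case base
    show ?case
      using subspace_products by (auto simp: fk.subspace_def distrib_left distrib_right)
  qed (use mon that(2) in auto)
  note mult = this
  show ?thesis
    using assms(2) unfolding products_def
  proof (induction rule: fk.span_induct)
    case base
    show ?case
      using subspace_products unfolding products_def by (auto simp: fk.subspace_def distrib_left)
  qed (use mult in \<open>auto simp: products_def\<close>)
qed

abbreviation "E12 \<equiv> \<lambda>i j. E1 i j \<or> E2 i j"

text \<open>\<open>products\<close> contains 1 and is stable under left multiplication by letters of
  both kinds, hence contains every word in the edges.\<close>

lemma products_eq: "products = fkG E12"
proof
  show "products \<subseteq> fkG E12"
    unfolding products_def
    using fkG_mono[of E1 E12] fkG_mono[of E2 E12]
    by (intro fk.span_minimal fk_subspace_fkG) (blast intro: fkG_mult)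
  have "fk_mon w \<in> products" if "w \<in> fk_words E12" for w
    using that
  proof (induction w)
    case Nil
    show ?case using mult_in_products[OF fkG_one fkG_one] by simp
  next
    case (Cons x w)
    then show ?case
      by (cases x) (auto simp: fk_mon_Cons products_left_E2 products_left_E1 fkG_gen)
  qed
  then show "fkG E12 \<subseteq> products"
    unfolding fkG_eq_span by (intro fk.span_minimal subspace_products) auto
qed

end

section \<open>The tensor product and its normal form\<close>

lemma tens_mult_eq_fa_ext: "tens_mult = fa_ext (\<lambda>x. fst x * snd x)"
  by (rule ext) (simp add: tens_mult_def fa_ext_def)

lemma tens_mult_simps [simp]:
  "tens_mult (Poly_Mapping.single (a, b) c) = fk_scale c (a * b)"
  "tens_mult (s + t) = tens_mult s + tens_mult t"
  "tens_mult (s - t) = tens_mult s - tens_mult t"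
  "tens_mult (fa_scale c t) = fk_scale c (tens_mult t)"
  "tens_mult 0 = 0"
  by (simp_all add: tens_mult_eq_fa_ext fa_ext_add fa_ext_diff fa_ext_scale)

lemma tens_mult_sum: "tens_mult (sum f A) = (\<Sum>x\<in>A. tens_mult (f x))"
  by (induction A rule: infinite_finite_induct) simp_all

text \<open>The easy half of the kernel description: multiplication is bilinear.\<close>

lemma tens_rel_kernel:
  assumes "t \<in> tens_rel U W"
  shows "tens_mult t = 0"
  using assms unfolding tens_rel_def
proof (induction rule: fa.span_induct)
  case base
  show ?case by (auto simp: fa.subspace_def)
qed (auto simp: tens_rel_gens_def distrib_left distrib_right)

lemma tens_rel_subspace: "fa.subspace (tens_rel U W)"
  unfolding tens_rel_def by (rule fa.subspace_span)

lemma tens_rel_generators: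
  assumes "a \<in> U" "b \<in> W"
  shows "a' \<in> U \<Longrightarrow> Poly_Mapping.single (a + a', b) 1 - Poly_Mapping.single (a, b) 1
      - Poly_Mapping.single (a', b) 1 \<in> tens_rel U W"
    and "b' \<in> W \<Longrightarrow> Poly_Mapping.single (a, b + b') 1 - Poly_Mapping.single (a, b) 1
      - Poly_Mapping.single (a, b') 1 \<in> tens_rel U W"
    and "Poly_Mapping.single (fk_scale c a, b) 1 - fa_scale c (Poly_Mapping.single (a, b) 1) \<in> tens_rel U W"
    and "Poly_Mapping.single (a, fk_scale c b) 1 - fa_scale c (Poly_Mapping.single (a, b) 1) \<in> tens_rel U W"
    and "Poly_Mapping.single (0, b) 1 \<in> tens_rel U W"
    and "Poly_Mapping.single (a, 0) 1 \<in> tens_rel U W"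
proof -
  show "a' \<in> U \<Longrightarrow> Poly_Mapping.single (a + a', b) 1 - Poly_Mapping.single (a, b) 1
      - Poly_Mapping.single (a', b) 1 \<in> tens_rel U W"
    using assms unfolding tens_rel_def tens_rel_gens_def by (intro fa.span_base) blast
  show "b' \<in> W \<Longrightarrow> Poly_Mapping.single (a, b + b') 1 - Poly_Mapping.single (a, b) 1
      - Poly_Mapping.single (a, b') 1 \<in> tens_rel U W"
    using assms unfolding tens_rel_def tens_rel_gens_def by (intro fa.span_base) blast
  show 3: "Poly_Mapping.single (fk_scale c a, b) 1 - fa_scale c (Poly_Mapping.single (a, b) 1) \<in> tens_rel U W" for c
    using assms unfolding tens_rel_def tens_rel_gens_def by (intro fa.span_base) blast
  show 4: "Poly_Mapping.single (a, fk_scale c b) 1 - fa_scale c (Poly_Mapping.single (a, b) 1) \<in> tens_rel U W" for c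
    using assms unfolding tens_rel_def tens_rel_gens_def by (intro fa.span_base) blast
  show "Poly_Mapping.single (0, b) 1 \<in> tens_rel U W" using 3[of 0] by simp
  show "Poly_Mapping.single (a, 0) 1 \<in> tens_rel U W" using 4[of 0] by simp
qed

definition tens_comb :: "'v fk set \<Rightarrow> ('v fk \<Rightarrow> 'v fk) \<Rightarrow> 'v tens" where
  "tens_comb F \<alpha> = (\<Sum>b\<in>F. Poly_Mapping.single (\<alpha> b, b) 1)"

text \<open>A tensor is in normal form when it is a sum of \<open>\<alpha> b \<otimes> b\<close>
  over finitely many \<open>b\<close> in \<open>B\<close>, modulo bilinearity. The coefficients
  vanish outside \<open>F\<close> so that two normal forms can be merged over the union of their
  index sets.\<close>

definition tens_normal :: "'v fk set \<Rightarrow> 'v fk set \<Rightarrow> 'v fk set \<Rightarrow> 'v tens \<Rightarrow> bool" where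
  "tens_normal U W B t \<longleftrightarrow> (\<exists>F \<alpha>. finite F \<and> F \<subseteq> B \<and> range \<alpha> \<subseteq> U \<and> (\<forall>b. b \<notin> F \<longrightarrow> \<alpha> b = 0)
     \<and> t - tens_comb F \<alpha> \<in> tens_rel U W)"

text \<open>The new summands are \<open>0 \<otimes> b\<close>, which vanish modulo
  bilinearity.\<close>

lemma tens_comb_enlarge:
  assumes "finite G" "F \<subseteq> G" "G \<subseteq> W" "\<forall>b. b \<notin> F \<longrightarrow> \<alpha> b = 0" "U \<noteq> {}"
  shows "tens_comb G \<alpha> - tens_comb F \<alpha> \<in> tens_rel U W"
proof -
  obtain a where a: "a \<in> U" using assms(5) by blast
  have "tens_comb G \<alpha> - tens_comb F \<alpha> = (\<Sum>b\<in>G - F. Poly_Mapping.single (\<alpha> b, b) 1)"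
    unfolding tens_comb_def using assms(1,2) by (simp add: sum_diff)
  also have "\<dots> \<in> tens_rel U W"
    using assms tens_rel_generators(5)[OF a] by (intro fa.subspace_sum tens_rel_subspace) auto
  finally show ?thesis .
qed

lemma tens_normal_cong:
  assumes "tens_normal U W B s" "t - s \<in> tens_rel U W"
  shows "tens_normal U W B t"
proof -
  obtain F \<alpha> where F: "finite F" "F \<subseteq> B" "range \<alpha> \<subseteq> U" "\<forall>b. b \<notin> F \<longrightarrow> \<alpha> b = 0"
    and s: "s - tens_comb F \<alpha> \<in> tens_rel U W" using assms(1) unfolding tens_normal_def by blast
  have "(t - s) + (s - tens_comb F \<alpha>) \<in> tens_rel U W"
    by (intro fa.subspace_add tens_rel_subspace assms s)
  then show ?thesis unfolding tens_normal_def using F by auto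
qed

lemma tens_normal_add:
  assumes U: "fk.subspace U" and BW: "B \<subseteq> W" and "tens_normal U W B s" "tens_normal U W B t"
  shows "tens_normal U W B (s + t)"
proof -
  obtain F \<alpha> where F: "finite F" "F \<subseteq> B" "range \<alpha> \<subseteq> U" "\<forall>b. b \<notin> F \<longrightarrow> \<alpha> b = 0"
    and s: "s - tens_comb F \<alpha> \<in> tens_rel U W" using assms(3) unfolding tens_normal_def by blast
  obtain G \<beta> where G: "finite G" "G \<subseteq> B" "range \<beta> \<subseteq> U" "\<forall>b. b \<notin> G \<longrightarrow> \<beta> b = 0"
    and t: "t - tens_comb G \<beta> \<in> tens_rel U W" using assms(4) unfolding tens_normal_def by blast
  let ?H = "F \<union> G" and ?g = "\<lambda>b. \<alpha> b + \<beta> b"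
  have ne: "U \<noteq> {}" using F(3) by auto
  have mem: "\<alpha> b \<in> U" "\<beta> b \<in> U" for b using F(3) G(3) by auto
  have e: "tens_comb ?H \<alpha> - tens_comb F \<alpha> \<in> tens_rel U W" "tens_comb ?H \<beta> - tens_comb G \<beta> \<in> tens_rel U W"
    using F G BW by (intro tens_comb_enlarge ne; auto)+
  have "tens_comb ?H ?g - tens_comb ?H \<alpha> - tens_comb ?H \<beta>
      = (\<Sum>b\<in>?H. Poly_Mapping.single (?g b, b) 1 - Poly_Mapping.single (\<alpha> b, b) 1 - Poly_Mapping.single (\<beta> b, b) 1)"
    by (simp add: tens_comb_def sum_subtractf)
  also have "\<dots> \<in> tens_rel U W"
    using F G BW mem by (intro fa.subspace_sum tens_rel_subspace tens_rel_generators(1)) auto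
  finally have sum: "tens_comb ?H ?g - tens_comb ?H \<alpha> - tens_comb ?H \<beta> \<in> tens_rel U W" .
  \<comment> \<open>This combination telescopes to \<open>s + t - tens_comb ?H ?g\<close>.\<close>
  have "(s - tens_comb F \<alpha>) + (t - tens_comb G \<beta>) - (tens_comb ?H \<alpha> - tens_comb F \<alpha>)
      - (tens_comb ?H \<beta> - tens_comb G \<beta>) - (tens_comb ?H ?g - tens_comb ?H \<alpha> - tens_comb ?H \<beta>)
      \<in> tens_rel U W"
    by (intro fa.subspace_add fa.subspace_diff tens_rel_subspace s t e sum)
  then have "s + t - tens_comb ?H ?g \<in> tens_rel U W" by (simp add: algebra_simps)
  moreover have "range ?g \<subseteq> U" using mem U by (auto intro: fk.subspace_add)
  ultimately show ?thesis
    unfolding tens_normal_def using F G by (intro exI[of _ ?H] exI[of _ ?g]) auto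
qed

lemma tens_normal_scale:
  assumes U: "fk.subspace U" and BW: "B \<subseteq> W" and "tens_normal U W B t"
  shows "tens_normal U W B (fa_scale c t)"
proof -
  obtain F \<alpha> where F: "finite F" "F \<subseteq> B" "range \<alpha> \<subseteq> U" "\<forall>b. b \<notin> F \<longrightarrow> \<alpha> b = 0"
    and t: "t - tens_comb F \<alpha> \<in> tens_rel U W" using assms(3) unfolding tens_normal_def by blast
  let ?g = "\<lambda>b. fk_scale c (\<alpha> b)"
  have mem: "\<alpha> b \<in> U" for b using F(3) by auto
  have "tens_comb F ?g - fa_scale c (tens_comb F \<alpha>)
      = (\<Sum>b\<in>F. Poly_Mapping.single (?g b, b) 1 - fa_scale c (Poly_Mapping.single (\<alpha> b, b) 1))"
    by (simp add: tens_comb_def sum_subtractf fa.scale_sum_right)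
  also have "\<dots> \<in> tens_rel U W"
    using F BW mem by (intro fa.subspace_sum tens_rel_subspace tens_rel_generators(3)) auto
  finally have sum: "tens_comb F ?g - fa_scale c (tens_comb F \<alpha>) \<in> tens_rel U W" .
  have "fa_scale c (t - tens_comb F \<alpha>) - (tens_comb F ?g - fa_scale c (tens_comb F \<alpha>)) \<in> tens_rel U W"
    by (intro fa.subspace_diff fa.subspace_scale tens_rel_subspace t sum)
  then have "fa_scale c t - tens_comb F ?g \<in> tens_rel U W"
    by (simp add: fa.scale_right_diff_distrib)
  moreover have "range ?g \<subseteq> U" using mem U by (auto intro: fk.subspace_scale)
  ultimately show ?thesis
    unfolding tens_normal_def using F by (intro exI[of _ F] exI[of _ ?g]) auto
qed

lemma tens_normal_zero:
  assumes "fk.subspace U"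
  shows "tens_normal U W B 0"
  unfolding tens_normal_def
  using fk.subspace_0[OF assms] fa.subspace_0[OF tens_rel_subspace]
  by (intro exI[of _ "{}"] exI[of _ "\<lambda>_. 0"]) (auto simp: tens_comb_def)

lemma tens_normal_single:
  assumes U: "fk.subspace U" and a: "a \<in> U" and b: "b \<in> fk.span B" and W: "W = fk.span B"
  shows "tens_normal U W B (Poly_Mapping.single (a, b) 1)"
proof -
  have BW: "B \<subseteq> W" using W by (auto intro: fk.span_base)
  have base: "tens_normal U W B (Poly_Mapping.single (a, b) 1)" if "b \<in> B" for b
    unfolding tens_normal_def
    using that a fk.subspace_0[OF U] fa.subspace_0[OF tens_rel_subspace]
    by (intro exI[of _ "{b}"] exI[of _ "\<lambda>b'. if b' = b then a else 0"]) (auto simp: tens_comb_def)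
  \<comment> \<open>Membership in \<open>W\<close> is carried through the induction because the
    additivity relations are available only for second factors in \<open>W\<close>.\<close>
  have "b \<in> W \<and> tens_normal U W B (Poly_Mapping.single (a, b) 1)"
    using b
  proof (induction rule: fk.span_induct_alt)
    case base
    have "tens_normal U W B (Poly_Mapping.single (a, 0) 1)"
      using tens_rel_generators(6)[OF a, of 0 W] W
      by (intro tens_normal_cong[OF tens_normal_zero[OF U]]) (simp add: fk.span_zero)
    then show ?case using W by (simp add: fk.span_zero)
  next
    case (step c x y)
    have x: "x \<in> W" "fk_scale c x \<in> W" using step W by (auto intro: fk.span_base fk.span_scale)
    have "tens_normal U W B (Poly_Mapping.single (a, fk_scale c x) 1)"
      by (rule tens_normal_cong[OF tens_normal_scale[OF U BW base[OF step(1)]] tens_rel_generators(4)[OF a x(1)]])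
    then have "tens_normal U W B (Poly_Mapping.single (a, fk_scale c x) 1 + Poly_Mapping.single (a, y) 1)"
      using step by (intro tens_normal_add[OF U BW]) auto
    moreover have "Poly_Mapping.single (a, fk_scale c x + y) 1
        - (Poly_Mapping.single (a, fk_scale c x) 1 + Poly_Mapping.single (a, y) 1) \<in> tens_rel U W"
      using tens_rel_generators(2)[OF a x(2), of y] step by (simp add: algebra_simps)
    ultimately have "tens_normal U W B (Poly_Mapping.single (a, fk_scale c x + y) 1)"
      by (rule tens_normal_cong)
    then show ?case using x step W by (auto intro: fk.span_add)
  qed
  then show ?thesis ..
qed

lemma tens_normal_free:
  assumes U: "fk.subspace U" and W: "W = fk.span B" and t: "t \<in> tens_free U W"
  shows "tens_normal U W B t"
proof -
  have BW: "B \<subseteq> W" using W by (auto intro: fk.span_base)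
  have "tens_normal U W B (\<Sum>x\<in>A. Poly_Mapping.single x (Poly_Mapping.lookup t x))"
    if "finite A" "A \<subseteq> U \<times> W" for A
    using that
  proof (induction A rule: finite_induct)
    case empty
    show ?case using tens_normal_zero[OF U] by simp
  next
    case (insert x A)
    obtain a b where x: "x = (a, b)" by fastforce
    have "tens_normal U W B (fa_scale (Poly_Mapping.lookup t x) (Poly_Mapping.single (a, b) 1))"
      using insert x W by (intro tens_normal_scale[OF U BW] tens_normal_single[OF U]) auto
    then show ?case
      using insert x by (simp add: tens_normal_add[OF U BW])
  qed
  from this[of "Poly_Mapping.keys t"] show ?thesis
    using t by (simp add: tens_free_def fa_sum_monomials)
qed

lemma tens_keys_sum_single:
  assumes "\<And>x. x \<in> A \<Longrightarrow> f x \<in> S"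
  shows "Poly_Mapping.keys (\<Sum>x\<in>A. Poly_Mapping.single (f x) (c x)) \<subseteq> S"
  using Poly_Mapping.keys_sum[of "\<lambda>x. Poly_Mapping.single (f x) (c x)" A] assms
  by (fastforce split: if_splits)

section \<open>Bases and Hilbert series\<close>

text \<open>A basis of monomials is homogeneous, as degree counting requires, and consists of words
  in the edges, as \<open>left_coefficients_zero\<close> requires.\<close>

lemma fkG_monomial_basis:
  obtains B where "B \<subseteq> fk_mon ` fk_words E" "fk.independent B" "fkG E = fk.span B"
proof -
  obtain B where B: "B \<subseteq> fk_mon ` fk_words E" "fk.independent B" "fk_mon ` fk_words E \<subseteq> fk.span B"
    by (rule fk.maximal_independent_subset)
  then have "fkG E = fk.span B"
    unfolding fkG_eq_span by (simp add: fk.span_eq) (metis fk.span_superset subset_trans)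
  with B that show ?thesis by blast
qed

section \<open>The multiplication isomorphism\<close>

context fk_split
begin

lemma mult_tensor_iso_split: "mult_tensor_iso (fkG E1) (fkG E2) (fkG E12)"
  unfolding mult_tensor_iso_def
proof (intro conjI ballI)
  let ?U = "fkG E1" and ?W = "fkG E2"
  show "tens_mult ` tens_free ?U ?W = fkG E12"
  proof
    show "tens_mult ` tens_free ?U ?W \<subseteq> fkG E12"
      unfolding products_eq[symmetric] tens_mult_def tens_free_def
      by (auto intro!: fk.subspace_sum fk.subspace_scale subspace_products mult_in_products)
    \<comment> \<open>Once the image is a subspace, it is enough that it contains the products that
      span \<open>products\<close>.\<close>
    have "fk.subspace (tens_mult ` tens_free ?U ?W)"
      unfolding fk.subspace_def
    proof (intro conjI ballI allI)
      show "0 \<in> tens_mult ` tens_free ?U ?W"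
        by (rule image_eqI[of _ _ 0]) (auto simp: tens_free_def)
    next
      fix x y assume "x \<in> tens_mult ` tens_free ?U ?W" "y \<in> tens_mult ` tens_free ?U ?W"
      then obtain s t where "x = tens_mult s" "y = tens_mult t" "s \<in> tens_free ?U ?W" "t \<in> tens_free ?U ?W"
        by blast
      then show "x + y \<in> tens_mult ` tens_free ?U ?W"
        using Poly_Mapping.keys_add[of s t]
        by (intro image_eqI[of _ _ "s + t"]) (auto simp: tens_free_def)
    next
      fix c x assume "x \<in> tens_mult ` tens_free ?U ?W"
      then obtain s where "x = tens_mult s" "s \<in> tens_free ?U ?W" by blast
      then show "fk_scale c x \<in> tens_mult ` tens_free ?U ?W"
        by (intro image_eqI[of _ _ "fa_scale c s"]) (auto simp: tens_free_def in_keys_iff)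
    qed
    moreover have "a * b \<in> tens_mult ` tens_free ?U ?W" if "a \<in> ?U" "b \<in> ?W" for a b
      using that by (intro image_eqI[of _ _ "Poly_Mapping.single (a, b) 1"]) (auto simp: tens_free_def)
    ultimately show "fkG E12 \<subseteq> tens_mult ` tens_free ?U ?W"
      unfolding products_eq[symmetric] products_def by (intro fk.span_minimal) auto
  qed
next
  fix t assume t: "t \<in> tens_free (fkG E1) (fkG E2)"
  show "tens_mult t = 0 \<longleftrightarrow> t \<in> tens_rel (fkG E1) (fkG E2)"
  proof
    assume 0: "tens_mult t = 0"
    \<comment> \<open>In normal form over a monomial basis of E_{G_2}, a tensor in the kernel
      becomes a relation with coefficients in E_{G_1}. These coefficients vanish, leaving only terms
      \<open>0 \<otimes> b\<close>.\<close>
    obtain B where B: "B \<subseteq> fk_mon ` fk_words E2" "fk.independent B" "fkG E2 = fk.span B"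
      by (rule fkG_monomial_basis)
    obtain F \<alpha> where F: "finite F" "F \<subseteq> B" "range \<alpha> \<subseteq> fkG E1"
      and tF: "t - tens_comb F \<alpha> \<in> tens_rel (fkG E1) (fkG E2)"
      using tens_normal_free[OF fk_subspace_fkG B(3) t] unfolding tens_normal_def by blast
    have "tens_mult (tens_comb F \<alpha>) = 0"
      using tens_rel_kernel[OF tF] 0 by simp
    then have sum: "(\<Sum>b\<in>F. \<alpha> b * b) = 0" by (simp add: tens_comb_def tens_mult_sum)
    have "\<alpha> b = 0" if "b \<in> F" for b
      using F(3) by (intro left_coefficients_zero[OF B(2,1) F(1,2) _ sum that]) auto
    then have "tens_comb F \<alpha> = (\<Sum>b\<in>F. Poly_Mapping.single (0, b) 1)"
      by (simp add: tens_comb_def)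
    also have "\<dots> \<in> tens_rel (fkG E1) (fkG E2)"
      using F B by (intro fa.subspace_sum tens_rel_subspace tens_rel_generators(5)[OF fkG_one])
        (auto intro: fk.span_base)
    finally have "(t - tens_comb F \<alpha>) + tens_comb F \<alpha> \<in> tens_rel (fkG E1) (fkG E2)"
      by (intro fa.subspace_add tens_rel_subspace tF)
    then show "t \<in> tens_rel (fkG E1) (fkG E2)" by simp
  qed (rule tens_rel_kernel)
next
  fix a t assume "a \<in> fkG E1" "t \<in> tens_free (fkG E1) (fkG E2)"
  then show "tens_lact a t \<in> tens_free (fkG E1) (fkG E2)"
    unfolding tens_lact_def tens_free_def mem_Collect_eq
    by (intro tens_keys_sum_single) (fastforce intro: fkG_mult)
  show "tens_mult (tens_lact a t) = a * tens_mult t"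
    unfolding tens_lact_def tens_mult_sum by (simp add: tens_mult_def[of t] sum_distrib_left mult.assoc)
next
  fix b t assume "b \<in> fkG E2" "t \<in> tens_free (fkG E1) (fkG E2)"
  then show "tens_ract t b \<in> tens_free (fkG E1) (fkG E2)"
    unfolding tens_ract_def tens_free_def mem_Collect_eq
    by (intro tens_keys_sum_single) (fastforce intro: fkG_mult)
  show "tens_mult (tens_ract t b) = tens_mult t * b"
    unfolding tens_ract_def tens_mult_sum by (simp add: tens_mult_def[of t] sum_distrib_right mult.assoc)
qed

text \<open>Grouping the terms by their second factor yields coefficients in E_{G_1}. They vanish by
  \<open>left_coefficients_zero\<close>, and then independence of \<open>B1\<close> applies.\<close>

lemma product_coefficients_zero:
  assumes B1: "fk.independent B1" "B1 \<subseteq> fkG E1"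
    and B2: "fk.independent B2" "B2 \<subseteq> fk_mon ` fk_words E2"
    and K: "finite K" "K \<subseteq> B1 \<times> B2" and sum: "(\<Sum>(a, b)\<in>K. fk_scale (c (a, b)) (a * b)) = 0"
    and x: "x \<in> K"
  shows "c x = 0"
proof -
  let ?F1 = "fst ` K" and ?F2 = "snd ` K"
  \<comment> \<open>Extension by zero lets the sum run over the full rectangle
    \<open>?F1 \<times> ?F2\<close>.\<close>
  define c' where "c' y = (if y \<in> K then c y else 0)" for y
  define \<alpha> where "\<alpha> b = (\<Sum>a\<in>?F1. fk_scale (c' (a, b)) a)" for b
  have F: "finite ?F1" "finite ?F2" "?F1 \<subseteq> B1" "?F2 \<subseteq> B2" "K \<subseteq> ?F1 \<times> ?F2"
    using K by force+
  have "(\<Sum>(a, b)\<in>K. fk_scale (c (a, b)) (a * b)) = (\<Sum>(a, b)\<in>?F1 \<times> ?F2. fk_scale (c' (a, b)) (a * b))"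
    using F by (intro sum.mono_neutral_cong_left) (auto simp: c'_def)
  also have "\<dots> = (\<Sum>b\<in>?F2. \<alpha> b * b)"
    unfolding sum.cartesian_product[symmetric] \<alpha>_def
    by (subst sum.swap) (simp add: sum_distrib_right)
  finally have "(\<Sum>b\<in>?F2. \<alpha> b * b) = 0" using sum by simp
  moreover have "\<alpha> b \<in> fkG E1" for b
    unfolding \<alpha>_def using F(3) B1(2)
    by (intro fk.subspace_sum fk.subspace_scale fk_subspace_fkG) auto
  ultimately have "\<alpha> (snd x) = 0"
    using left_coefficients_zero[OF B2 F(2,4), of \<alpha> "snd x"] x by blast
  then have "c' (fst x, snd x) = 0"
    unfolding \<alpha>_def
    using fk.independentD[OF B1(1) F(1,3), of "\<lambda>a. c' (a, snd x)" "fst x"] x by blast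
  then show ?thesis using x by (simp add: c'_def)
qed

end

section \<open>The product formula for Hilbert series\<close>

lemma (in fk_split) hilb_split:
  assumes "finite (UNIV :: 'v set)"
  shows "fk_hilb E1 * fk_hilb E2 = fk_hilb E12"
proof -
  obtain B1 where B1: "B1 \<subseteq> fk_mon ` fk_words E1" "fk.independent B1" "fkG E1 = fk.span B1"
    by (rule fkG_monomial_basis)
  obtain B2 where B2: "B2 \<subseteq> fk_mon ` fk_words E2" "fk.independent B2" "fkG E2 = fk.span B2"
    by (rule fkG_monomial_basis)
  have B1_sub: "B1 \<subseteq> fkG E1" using B1 fk.span_superset by blast
  define mul where "mul = (\<lambda>(a, b). a * b :: 'v fk)"
  \<comment> \<open>\<open>C\<close> will be a homogeneous basis of E_G; both sides of the formula
    are then obtained by counting basis elements by degree.\<close>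
  define C where "C = mul ` (B1 \<times> B2)"
  note coeff = product_coefficients_zero[OF B1(2) B1_sub B2(2,1)]
  have inj: "inj_on mul (B1 \<times> B2)"
  proof (rule inj_onI, rule ccontr)
    fix x y assume xy: "x \<in> B1 \<times> B2" "y \<in> B1 \<times> B2" "mul x = mul y" "x \<noteq> y"
    \<comment> \<open>Two distinct pairs with equal product would satisfy a relation with
      coefficients 1 and -1.\<close>
    have "(if x = x then 1 else - 1 :: rat) = 0"
      by (rule coeff[of "{x, y}" "\<lambda>z. if z = x then 1 else - 1" x])
        (use xy in \<open>auto simp: mul_def case_prod_beta\<close>)
    then show False by simp
  qed
  have indep: "fk.independent C"
    unfolding fk.independent_explicit_module
  proof (intro allI impI)
    fix t u v assume t: "finite t" "t \<subseteq> C" "(\<Sum>v\<in>t. fk_scale (u v) v) = 0" "v \<in> t"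
    obtain K where K: "K \<subseteq> B1 \<times> B2" "finite K" "t = mul ` K"
      using finite_subset_image[OF t(1) t(2)[unfolded C_def]] by blast
    obtain x where x: "x \<in> K" "v = mul x" using t(4) K(3) by blast
    have "(\<Sum>x\<in>K. fk_scale (u (mul x)) (mul x)) = 0"
      using t(3) sum.reindex[OF inj_on_subset[OF inj K(1)], of "\<lambda>v. fk_scale (u v) v"] K(3)
      by (simp add: comp_def)
    then have "(\<Sum>(a, b)\<in>K. fk_scale (u (mul (a, b))) (a * b)) = 0"
      by (simp add: mul_def case_prod_beta)
    from coeff[OF K(2,1) this x(1)] show "u v = 0" using x(2) by simp
  qed
  have span: "fkG E12 = fk.span C"
  proof
    have "a * b \<in> fk.span C" if "a \<in> fkG E1" "b \<in> fkG E2" for a b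
      using that unfolding B1(3) B2(3)
      by (rule fk_span_mult[OF _ _ fk.subspace_span]) (force simp: C_def mul_def intro: fk.span_base)
    then show "fkG E12 \<subseteq> fk.span C"
      unfolding products_eq[symmetric] products_def by (intro fk.span_minimal fk.subspace_span) auto
    have "B2 \<subseteq> fkG E2" using B2 fk.span_superset by blast
    then show "fk.span C \<subseteq> fkG E12"
      unfolding products_eq[symmetric] using B1_sub
      by (intro fk.span_minimal subspace_products) (auto simp: C_def mul_def intro!: mult_in_products)
  qed
  have hom1: "\<exists>e. a \<in> fk_deg e" if "a \<in> B1" for a using that B1(1) fk_mon_deg by blast
  have hom2: "\<exists>e. b \<in> fk_deg e" if "b \<in> B2" for b using that B2(1) fk_mon_deg by blast
  have hom: "\<exists>e. c \<in> fk_deg e" if c: "c \<in> C" for c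
  proof -
    obtain a b where ab: "c = a * b" "a \<in> B1" "b \<in> B2" using c by (auto simp: C_def mul_def)
    obtain i j where "a \<in> fk_deg i" "b \<in> fk_deg j" using hom1[OF ab(2)] hom2[OF ab(3)] by blast
    then show ?thesis using fk_deg_mult ab(1) by blast
  qed
  \<comment> \<open>Only nonzero elements have a unique degree.\<close>
  have nz1: "0 \<notin> B1" and nz2: "0 \<notin> B2" and nz: "0 \<notin> C"
    using B1(2) B2(2) indep fk.dependent_zero by blast+
  \<comment> \<open>Finitely many vertices give finitely many words of each length. Finiteness
    matters because \<open>card\<close> is 0 on infinite sets.\<close>
  have fin: "finite (B \<inter> fk_deg d)" if B: "B \<subseteq> range fk_mon" "0 \<notin> B" for B :: "'v fk set" and d
  proof (rule finite_subset)
    show "B \<inter> fk_deg d \<subseteq> fk_mon ` {w. set w \<subseteq> UNIV \<and> length w = d}"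
      using B fk_mon_deg fk_deg_unique by fastforce
    have "finite (UNIV :: ('v \<times> 'v) set)" using assms by (simp add: finite_prod)
    then show "finite (fk_mon ` {w :: 'v word. set w \<subseteq> UNIV \<and> length w = d})"
      by (intro finite_imageI finite_lists_length_eq)
  qed
  have fin1: "finite (B1 \<inter> fk_deg d)" and fin2: "finite (B2 \<inter> fk_deg d)" for d
    using B1(1) B2(1) nz1 nz2 by (auto intro!: fin)
  \<comment> \<open>Degrees add under multiplication, so the degree-\<open>d\<close> part of
    \<open>C\<close> is the image of disjoint rectangles indexed by the degree of the first factor;
    this is the Cauchy product.\<close>
  have card: "card (C \<inter> fk_deg d) = (\<Sum>i=0..d. card (B1 \<inter> fk_deg i) * card (B2 \<inter> fk_deg (d - i)))" for d
  proof -
    let ?P = "\<lambda>i. (B1 \<inter> fk_deg i) \<times> (B2 \<inter> fk_deg (d - i))"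
    have "C \<inter> fk_deg d = mul ` (\<Union>i\<in>{0..d}. ?P i)"
    proof (intro equalityI subsetI)
      fix c assume c: "c \<in> C \<inter> fk_deg d"
      then obtain a b where ab: "c = a * b" "a \<in> B1" "b \<in> B2" by (auto simp: C_def mul_def)
      obtain i j where ij: "a \<in> fk_deg i" "b \<in> fk_deg j" using hom1[OF ab(2)] hom2[OF ab(3)] by blast
      have "c \<noteq> 0" using c nz by blast
      then have "i + j = d" using fk_deg_unique[of c "i + j" d] fk_deg_mult[OF ij] c ab(1) by blast
      then have "i \<in> {0..d}" "(a, b) \<in> ?P i" using ab ij by auto
      then show "c \<in> mul ` (\<Union>i\<in>{0..d}. ?P i)" using ab(1) by (force simp: mul_def)
    next
      fix c assume "c \<in> mul ` (\<Union>i\<in>{0..d}. ?P i)"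
      then obtain i a b where i: "i \<le> d" "a \<in> B1" "a \<in> fk_deg i" "b \<in> B2" "b \<in> fk_deg (d - i)" "c = a * b"
        by (auto simp: mul_def)
      then show "c \<in> C \<inter> fk_deg d"
        using fk_deg_mult[OF i(3,5)] by (force simp: C_def mul_def)
    qed
    then have "card (C \<inter> fk_deg d) = card (\<Union>i\<in>{0..d}. ?P i)"
      using inj by (auto intro!: card_image elim: inj_on_subset)
    also have "\<dots> = (\<Sum>i=0..d. card (?P i))"
    proof (rule card_UN_disjoint)
      show "\<forall>i\<in>{0..d}. finite (?P i)" using fin1 fin2 by blast
      show "\<forall>i\<in>{0..d}. \<forall>j\<in>{0..d}. i \<noteq> j \<longrightarrow> ?P i \<inter> ?P j = {}"
        using fk_deg_unique nz1 by blast
    qed simp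
    finally show ?thesis by (simp add: card_cartesian_product)
  qed
  show ?thesis
    by (rule fps_ext)
      (simp add: fk_hilb_def fps_mult_nth span B1(3) B2(3) card
        fk_dim_homogeneous[OF indep hom] fk_dim_homogeneous[OF B1(2) hom1] fk_dim_homogeneous[OF B2(2) hom2])
qed

theorem mainTheorem7:
  fixes E E1 E2 :: "'v::finite \<Rightarrow> 'v \<Rightarrow> bool"
  assumes "symp E" and "irreflp E"
    and "symp E1" and "symp E2"
    and "\<forall>i j. E i j \<longleftrightarrow> E1 i j \<or> E2 i j"
    and "\<forall>i j. \<not> (E1 i j \<and> E2 i j)"
    and "\<forall>j k. E2\<^sup>*\<^sup>* j k \<longrightarrow> (\<forall>i. i \<noteq> j \<and> i \<noteq> k \<longrightarrow> (E1 i j \<longleftrightarrow> E1 i k))"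
  shows "mult_tensor_iso (fkG E1) (fkG E2) (fkG E) \<and> fk_hilb E1 * fk_hilb E2 = fk_hilb E"
proof -
  \<comment> \<open>Irreflexivity of \<open>E1\<close> and \<open>E2\<close> is inherited from
    \<open>E\<close>.\<close>
  interpret fk_split E1 E2
    using assms by unfold_locales (auto dest: sympD irreflpD)
  have "E = (\<lambda>i j. E1 i j \<or> E2 i j)" using assms(5) by blast
  then show ?thesis
    using mult_tensor_iso_split hilb_split[OF finite_class.finite_UNIV] by simp
qed

end
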